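(* Let $\varepsilon^*>0$ be sufficiently small. Then there exists a finite point set $S\subset\mathbb{R}^2$ such that every subset $T\subseteq S$ which intersects every line containing at least $\varepsilon^*|S|$ points of $S$ (i.e., every $\varepsilon^*$-net $T\subseteq S$ for lines) satisfies $$|T|\ge \frac{1}{2\varepsilon^*}\,\log^{1/3}\!\Big(\frac{1}{\varepsilon^*}\Big)\Big/\log\log\Big(\frac{1}{\varepsilon^*}\Big).$$
   Context: Logarithms are to base 2. For a finite point set $S$ in the plane, a set $T\subseteq S$ is an $\varepsilon$-net (with respect to lines) if $T$ contains a point of every line $\ell$ with $|\ell\cap S|\ge \varepsilon|S|$. *)

theory Defs
  imports Complex_Main
begin

definition is_line :: "(real \<times> real) set \<Rightarrow> bool" where
  "is_line L \<longleftrightarrow> (\<exists>a b c. (a, b) \<noteq> (0, 0) \<and> L = {(x, y). a * x + b * y = c})"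

definition eps_net_lines :: "real \<Rightarrow> (real \<times> real) set \<Rightarrow> (real \<times> real) set \<Rightarrow> bool" where
  "eps_net_lines eps S T \<longleftrightarrow> T \<subseteq> S \<and>
     (\<forall>L. is_line L \<and> real (card (L \<inter> S)) \<ge> eps * real (card S) \<longrightarrow> T \<inter> L \<noteq> {})"

end

theory Submission
  imports Defs "HOL-Library.FuncSet" "HOL-Real_Asymp.Real_Asymp"
begin

text \<open>
  The points are a sparse random sample of the grid of columns \<open>0, \<dots>, M - 1\<close> and heights below
  \<open>mu\<close>, where \<open>M\<close> is a large multiple of \<open>k\<close>, and the lines are \<open>y = a x + b\<close> with slope \<open>a\<close> below
  \<open>R ^ (k - 1)\<close>. The sample has \<open>s\<close> points with \<open>s \<le> k / eps\<close>, and it is so sparse that, after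
  deletion of few points, no line of the family carries more than \<open>k\<close> of them. If \<open>T\<close> is an
  \<open>eps\<close>-net, its complement in the sample then contains no \<open>k\<close> points of any line of the family,
  so it suffices that such line-free subsets have fewer than \<open>s / 3\<close> points.

  This is a container argument. Inside a dense subset of the grid, many lines are full on some
  fixed \<open>k\<close> columns. Going through these columns one by one, one picks in the line-free set \<open>I\<close> few
  points lying on as many surviving lines as possible and keeps only the lines through them,
  discarding lines through points of later columns that are already saturated. Since two points
  determine a line, this works down to a stage at which a positive proportion of a column is seen
  to be disjoint from \<open>I\<close>. Iterating, \<open>I\<close> is confined to a set of density \<open>1 / 4096\<close> that depends
  only on the few picked points, and a union bound over these finishes the proof. The sampling
  rate exceeds the rate of picked points by a factor that is exponential in \<open>k log k\<close> already for
  \<open>log s\<close> of order \<open>k ^ 3 log k\<close>.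
\<close>

section \<open>Fingerprints\<close>

text \<open>
  The set \<open>F\<close> is the fingerprint of \<open>I\<close>. Taking \<open>I' = F\<close> shows that \<open>A I\<close> is a function of it; the
  intermediate sets \<open>I'\<close> make the notion stable under sequential composition.
\<close>
definition determined :: "nat \<Rightarrow> ('a set \<Rightarrow> 'b) \<Rightarrow> bool" where
  "determined t A \<longleftrightarrow> (\<forall>I. finite I \<longrightarrow>
     (\<exists>F\<subseteq>I. card F \<le> t \<and> (\<forall>I'. F \<subseteq> I' \<and> I' \<subseteq> I \<longrightarrow> A I' = A I)))"

lemma determined_const: "determined t (\<lambda>_. c)"
  unfolding determined_def by (intro allI impI exI[of _ "{}"]) auto

text \<open>The union of a fingerprint of \<open>I\<close> for \<open>A\<close> and one for
  \<open>B (A I)\<close> works: an intermediate set containing both leaves \<open>A I\<close>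
  unchanged, so the second fingerprint still refers to the same map \<open>B (A I)\<close>.\<close>

lemma determined_bind:
  assumes "determined t A" and "\<And>a. determined u (B a)"
  shows "determined (t + u) (\<lambda>I. B (A I) I)"
  unfolding determined_def
proof (intro allI impI)
  fix I :: "'a set"
  assume "finite I"
  obtain F1 where F1: "F1 \<subseteq> I" "card F1 \<le> t" "\<And>I'. F1 \<subseteq> I' \<Longrightarrow> I' \<subseteq> I \<Longrightarrow> A I' = A I"
    using assms(1)[unfolded determined_def, rule_format, OF \<open>finite I\<close>] by metis
  obtain F2 where F2: "F2 \<subseteq> I" "card F2 \<le> u"
      "\<And>I'. F2 \<subseteq> I' \<Longrightarrow> I' \<subseteq> I \<Longrightarrow> B (A I) I' = B (A I) I"
    using assms(2)[of "A I", unfolded determined_def, rule_format, OF \<open>finite I\<close>] by metis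
  have "card (F1 \<union> F2) \<le> t + u"
    using F1(2) F2(2) card_Un_le[of F1 F2] by linarith
  moreover have "B (A I') I' = B (A I) I" if "F1 \<union> F2 \<subseteq> I' \<and> I' \<subseteq> I" for I'
  proof -
    have "A I' = A I" using that by (intro F1(3)) auto
    moreover have "B (A I) I' = B (A I) I" using that by (intro F2(3)) auto
    ultimately show ?thesis by metis
  qed
  moreover have "F1 \<union> F2 \<subseteq> I" using F1(1) F2(1) by (rule Un_least)
  ultimately show "\<exists>F\<subseteq>I. card F \<le> t + u \<and>
      (\<forall>I'. F \<subseteq> I' \<and> I' \<subseteq> I \<longrightarrow> B (A I') I' = B (A I) I)"
    by blast
qed

lemma determined_funpow:
  fixes f :: "'s \<Rightarrow> 'a set \<Rightarrow> 's"
  assumes "\<And>x. determined 1 (f x)"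
  shows "determined n (\<lambda>I. ((\<lambda>x. f x I) ^^ n) x0)"
proof (induction n)
  case 0
  show ?case by (simp add: determined_const)
next
  case (Suc n)
  show ?case using determined_bind[OF Suc assms] by simp
qed

text \<open>The choice of the least maximiser makes the choice independent of the rest of \<open>Y\<close>.\<close>
definition greedy :: "(nat \<Rightarrow> nat) \<Rightarrow> nat set \<Rightarrow> nat" where
  "greedy d Y = (LEAST y. y \<in> Y \<and> (\<forall>z\<in>Y. d z \<le> d y))"

lemma greedy:
  assumes "finite Y" "Y \<noteq> {}"
  shows "greedy d Y \<in> Y" "z \<in> Y \<Longrightarrow> d z \<le> d (greedy d Y)"
proof -
  have "Max (d ` Y) \<in> d ` Y" using assms by simp
  then obtain y where "y \<in> Y" "d y = Max (d ` Y)" by auto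
  then have "y \<in> Y \<and> (\<forall>z\<in>Y. d z \<le> d y)" using assms by simp
  from LeastI[of "\<lambda>y. y \<in> Y \<and> (\<forall>z\<in>Y. d z \<le> d y)", OF this]
  show "greedy d Y \<in> Y" "z \<in> Y \<Longrightarrow> d z \<le> d (greedy d Y)" by (simp_all add: greedy_def)
qed

lemma greedy_subset:
  assumes "finite Y" "Y' \<subseteq> Y" "greedy d Y \<in> Y'"
  shows "greedy d Y' = greedy d Y"
proof -
  have ne: "Y \<noteq> {}" using assms by auto
  note g = greedy[OF assms(1) ne]
  show ?thesis
    unfolding greedy_def[of d Y']
  proof (rule Least_equality)
    show "greedy d Y \<in> Y' \<and> (\<forall>z\<in>Y'. d z \<le> d (greedy d Y))" using g assms by auto
    fix y assume y: "y \<in> Y' \<and> (\<forall>z\<in>Y'. d z \<le> d y)"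
    have "d z \<le> d y" if "z \<in> Y" for z
      using g(2)[OF that] y assms(3) by (meson order_trans)
    then have "y \<in> Y \<and> (\<forall>z\<in>Y. d z \<le> d y)" using y assms(2) by auto
    then show "greedy d Y \<le> y" unfolding greedy_def by (rule Least_le)
  qed
qed

text \<open>The picked point is itself the fingerprint: it remains the least maximiser in every
  subset that contains it, and an empty column stays empty in every subset.\<close>

lemma determined_greedy:
  "determined 1 (\<lambda>I. if I `` {j} = {} then c else g (greedy d (I `` {j})))"
  unfolding determined_def
proof (intro allI impI)
  fix I :: "('a \<times> nat) set"
  assume "finite I"
  then have fin: "finite (I `` {j})" by (rule finite_Image)
  let ?F = "if I `` {j} = {} then {} else {(j, greedy d (I `` {j}))}"
  have "?F \<subseteq> I" using greedy(1)[OF fin] by auto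
  moreover have "card ?F \<le> 1" by simp
  moreover have "(if I' `` {j} = {} then c else g (greedy d (I' `` {j}))) =
      (if I `` {j} = {} then c else g (greedy d (I `` {j})))" if "?F \<subseteq> I'" "I' \<subseteq> I" for I'
  proof (cases "I `` {j} = {}")
    case True
    then have "I' `` {j} = {}" using that by auto
    then show ?thesis using True by simp
  next
    case False
    then have *: "greedy d (I `` {j}) \<in> I' `` {j}" using that by auto
    then show ?thesis using False greedy_subset[OF fin Image_mono[OF that(2) order_refl] *] by auto
  qed
  ultimately show "\<exists>F\<subseteq>I. card F \<le> 1 \<and> (\<forall>I'. F \<subseteq> I' \<and> I' \<subseteq> I \<longrightarrow>
      (if I' `` {j} = {} then c else g (greedy d (I' `` {j}))) =
      (if I `` {j} = {} then c else g (greedy d (I `` {j}))))"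
    by blast
qed

section \<open>The greedy algorithm in one column\<close>

text \<open>The pair \<open>(a, b)\<close> stands for the line \<open>y = a x + b\<close>.\<close>
type_synonym line_set = "(nat \<times> nat) set"

definition height :: "nat \<Rightarrow> nat \<times> nat \<Rightarrow> nat" where
  "height j l = fst l * j + snd l"

definition pencil :: "line_set \<Rightarrow> nat \<Rightarrow> nat \<Rightarrow> line_set" where
  "pencil L j y = {l \<in> L. height j l = y}"

text \<open>Subtracting the two equations gives \<open>(a - a') * (i - j) = 0\<close>; this is done
  in the integers because natural subtraction truncates.\<close>

lemma height_unique:
  assumes "i \<noteq> j" "height i l = height i l'" "height j l = height j l'"
  shows "l = l'"
proof -
  obtain a b a' b' where l: "l = (a, b)" "l' = (a', b')" by fastforce
  have "int a * i + b = int a' * i + b'" "int a * j + b = int a' * j + b'"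
    using assms(2,3) unfolding l height_def by (simp_all flip: of_nat_mult of_nat_add)
  then have "(int a - a') * (int i - j) = 0" by (simp add: algebra_simps)
  then have "a = a'" using assms(1) by simp
  then show ?thesis using assms(2) by (simp add: l height_def)
qed

lemma card_le_fibres:
  fixes d :: real
  assumes "finite L" "\<And>y. real (card (pencil L i y)) \<le> d"
  shows "real (card L) \<le> real (card (height i ` L)) * d"
proof -
  have "L = (\<Union>y\<in>height i ` L. pencil L i y)" by (auto simp: pencil_def)
  then have "card L \<le> (\<Sum>y\<in>height i ` L. card (pencil L i y))"
    by (metis card_UN_le assms(1) finite_imageI)
  then have "real (card L) \<le> (\<Sum>y\<in>height i ` L. real (card (pencil L i y)))"
    by (simp flip: of_nat_sum)
  also have "\<dots> \<le> real (card (height i ` L)) * d"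
    using sum_bounded_above[of "height i ` L" "\<lambda>y. real (card (pencil L i y))" d] assms(2) by simp
  finally show ?thesis .
qed

lemma card_saturated_le:
  assumes "finite L" "Y \<subseteq> {y. d \<le> card (pencil L i y)}" "finite Y"
  shows "card Y * d \<le> card L"
proof -
  have "card Y * d \<le> (\<Sum>y\<in>Y. card (pencil L i y))"
    using sum_bounded_below[of Y d "\<lambda>y. card (pencil L i y)"] assms(2) by auto
  also have "\<dots> = card (\<Union>y\<in>Y. pencil L i y)"
    using assms by (subst card_UN_disjoint) (auto simp: pencil_def)
  also have "\<dots> \<le> card L" by (intro card_mono assms) (auto simp: pencil_def)
  finally show ?thesis .
qed

text \<open>
  In a state \<open>(A, L)\<close>, the set \<open>A\<close> holds the lines still available and \<open>L\<close> those through the points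
  picked so far in column \<open>j\<close>. The bound \<open>d\<close> caps the number of lines of \<open>L\<close> through a point of a
  column in \<open>js\<close>.
\<close>
definition absorb :: "nat set \<Rightarrow> nat \<Rightarrow> nat \<Rightarrow> line_set \<times> line_set \<Rightarrow> nat \<Rightarrow> line_set \<times> line_set" where
  "absorb js d j = (\<lambda>(A, L) y. let L' = L \<union> pencil A j y in
     ({l \<in> A - pencil A j y. \<forall>i\<in>js. card (pencil L' i (height i l)) < d}, L'))"

definition greedy_step ::
    "nat set \<Rightarrow> nat \<Rightarrow> nat \<Rightarrow> line_set \<times> line_set \<Rightarrow> (nat \<times> nat) set \<Rightarrow> line_set \<times> line_set" where
  "greedy_step js d j x I = (if I `` {j} = {} then x else
     absorb js d j x (greedy (\<lambda>y. card (pencil (fst x) j y)) (I `` {j})))"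

lemma determined_greedy_step: "determined 1 (greedy_step js d j x)"
  unfolding greedy_step_def by (rule determined_greedy)

text \<open>A line in neither set was discarded at a saturated point, which limits the loss. The
  last clause bounds the available lines through a point of \<open>I\<close> in column
  \<open>j\<close>: each of the \<open>t\<close> picks gathered at least as many lines as such a
  point still has.\<close>

definition greedy_inv ::
    "nat set \<Rightarrow> nat \<Rightarrow> nat \<Rightarrow> line_set \<Rightarrow> (nat \<times> nat) set \<Rightarrow> nat \<Rightarrow> line_set \<times> line_set \<Rightarrow> bool" where
  "greedy_inv js d j L0 I t = (\<lambda>(A, L). A \<subseteq> L0 \<and> L \<subseteq> L0 \<and> A \<inter> L = {} \<and>
     (\<forall>i\<in>js. \<forall>y. card (pencil L i y) \<le> d) \<and>
     (\<forall>l\<in>A. \<forall>i\<in>js. card (pencil L i (height i l)) < d) \<and>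
     (\<forall>l\<in>L0 - A - L. \<exists>i\<in>js. d \<le> card (pencil L i (height i l))) \<and>
     (\<forall>l\<in>L. (j, height j l) \<in> I) \<and>
     (\<forall>y. (j, y) \<in> I \<longrightarrow> t * card (pencil A j y) \<le> card L))"

lemma pencil_mono: "A \<subseteq> B \<Longrightarrow> pencil A j y \<subseteq> pencil B j y"
  by (auto simp: pencil_def)

lemma finite_pencil: "finite A \<Longrightarrow> finite (pencil A j y)"
  by (simp add: pencil_def)

lemma greedy_inv_step:
  assumes "finite L0" "finite I" "j \<notin> js" "greedy_inv js d j L0 I t x"
  shows "greedy_inv js d j L0 I (Suc t) (greedy_step js d j x I)"
proof -
  obtain A L where x: "x = (A, L)" by fastforce
  from assms(4) have inv: "A \<subseteq> L0" "L \<subseteq> L0" "A \<inter> L = {}"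
     "\<And>i y. i \<in> js \<Longrightarrow> card (pencil L i y) \<le> d"
     "\<And>l i. l \<in> A \<Longrightarrow> i \<in> js \<Longrightarrow> card (pencil L i (height i l)) < d"
     "\<And>l. l \<in> L0 - A - L \<Longrightarrow> \<exists>i\<in>js. d \<le> card (pencil L i (height i l))"
     "\<And>l. l \<in> L \<Longrightarrow> (j, height j l) \<in> I"
     "\<And>y. (j, y) \<in> I \<Longrightarrow> t * card (pencil A j y) \<le> card L"
    unfolding x greedy_inv_def by auto
  have finA: "finite A" and finL: "finite L" using inv(1,2) assms(1) finite_subset by blast+
  show ?thesis
  proof (cases "I `` {j} = {}")
    case True
    then show ?thesis using inv by (auto simp: x greedy_step_def greedy_inv_def)
  next
    case False
    define v where "v = greedy (\<lambda>y. card (pencil A j y)) (I `` {j})"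
    define L' where "L' = L \<union> pencil A j v"
    define A' where "A' = {l \<in> A - pencil A j v. \<forall>i\<in>js. card (pencil L' i (height i l)) < d}"
    have fin: "finite (I `` {j})" using assms(2) by (rule finite_Image)
    have v: "(j, v) \<in> I" "\<And>z. (j, z) \<in> I \<Longrightarrow> card (pencil A j z) \<le> card (pencil A j v)"
      using greedy[OF fin False, where d = "\<lambda>y. card (pencil A j y)"] unfolding v_def by auto
    have step: "greedy_step js d j x I = (A', L')"
      using False unfolding x greedy_step_def A'_def L'_def v_def by (simp add: absorb_def Let_def)
    have finL': "finite L'" using finA finL by (simp add: L'_def finite_pencil)
    have pA: "pencil A j v \<subseteq> A" by (auto simp: pencil_def)
    have mono: "card (pencil L i y) \<le> card (pencil L' i y)" for i y
      using finL' by (intro card_mono finite_pencil pencil_mono) (auto simp: L'_def)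
    \<comment> \<open>The lines of the new pencil share a point in column \<open>j\<close>, so at
      most one of them passes through a given point of another column. That line was available,
      hence the point had fewer than \<open>d\<close> lines before.\<close>
    have cap: "card (pencil L' i y) \<le> d" if i: "i \<in> js" for i y
    proof (cases "pencil (pencil A j v) i y = {}")
      case True
      then have "pencil L' i y = pencil L i y" by (auto simp: L'_def pencil_def)
      then show ?thesis using inv(4)[OF i] by simp
    next
      case False
      then obtain l where l: "l \<in> A" "height j l = v" "height i l = y" by (auto simp: pencil_def)
      have "i \<noteq> j" using i assms(3) by auto
      then have "l' = l" if "l' \<in> pencil A j v" "height i l' = y" for l'
        using that l by (intro height_unique[of i j]) (auto simp: pencil_def)
      then have "pencil L' i y \<subseteq> insert l (pencil L i y)"
        by (auto simp: L'_def pencil_def)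
      then have "card (pencil L' i y) \<le> card (insert l (pencil L i y))"
        using finL by (intro card_mono) (simp_all add: finite_pencil)
      also have "\<dots> \<le> Suc (card (pencil L i y))" by (simp add: card_insert_if finL finite_pencil)
      also have "\<dots> \<le> d" using inv(5)[OF l(1) i] l(3) by simp
      finally show ?thesis .
    qed
    have sat: "\<exists>i\<in>js. d \<le> card (pencil L' i (height i l))" if "l \<in> L0 - A' - L'" for l
    proof (cases "l \<in> A")
      case True
      then show ?thesis using that by (force simp: A'_def L'_def not_less)
    next
      case False
      then have "l \<in> L0 - A - L" using that by (auto simp: L'_def)
      then show ?thesis using inv(6) mono by (meson order_trans)
    qed
    have card_L': "card L' = card L + card (pencil A j v)"
      unfolding L'_def using finA finL inv(3) pA by (intro card_Un_disjoint) (auto simp: finite_pencil)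
    have le: "card (pencil A' j y) \<le> card (pencil A j y)" for y
      using finA by (intro card_mono finite_pencil pencil_mono) (auto simp: A'_def)
    \<comment> \<open>The pick maximises the available pencil, so \<open>card L\<close> grows by at
      least the pencil of any \<open>y\<close> with \<open>(j, y)\<close> in \<open>I\<close>; the
      available pencils only shrink.\<close>
    have count: "Suc t * card (pencil A' j y) \<le> card L'" if "(j, y) \<in> I" for y
      using inv(8)[OF that] v(2)[OF that] le[of y] mult_le_mono2[OF le, of t y]
      unfolding mult_Suc card_L' by linarith
    show ?thesis
      unfolding step greedy_inv_def prod.case
    proof (intro conjI ballI allI impI)
      show "A' \<subseteq> L0" "L' \<subseteq> L0" "A' \<inter> L' = {}"
        using inv(1-3) pA by (auto simp: A'_def L'_def)
      show "(j, height j l) \<in> I" if "l \<in> L'" for l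
        using that inv(7)[of l] v(1) by (auto simp: L'_def pencil_def)
    qed (use cap sat count in \<open>auto simp: A'_def\<close>)
  qed
qed

lemma greedy_inv_run:
  assumes "finite L" "finite I" "j \<notin> js" "0 < d"
  shows "greedy_inv js d j L I t (((\<lambda>x. greedy_step js d j x I) ^^ t) (L, {}))"
proof (induction t)
  case 0
  show ?case using assms(4) by (simp add: greedy_inv_def pencil_def)
next
  case (Suc t)
  then show ?case using greedy_inv_step[OF assms(1-3)] by simp
qed

text \<open>A line no longer available was collected in \<open>L'\<close> or meets a saturated
  point. A column of \<open>js\<close> has at most \<open>card L' / d\<close> saturated points, each
  on at most \<open>R * d\<close> lines of \<open>L\<close>, so it costs at most
  \<open>card L' * R\<close> lines.\<close>

lemma greedy_inv_card_removed:
  assumes "finite L" "finite js" "0 < d" "greedy_inv js d j L I t (A, L')"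
    and deg: "\<And>i y. i \<in> js \<Longrightarrow> card (pencil L i y) \<le> R * d"
  shows "card (L - A) \<le> card L' * (1 + card js * R)"
proof -
  have inv: "L' \<subseteq> L" "\<And>l. l \<in> L - A - L' \<Longrightarrow> \<exists>i\<in>js. d \<le> card (pencil L' i (height i l))"
    using assms(4) unfolding greedy_inv_def by auto
  have finL': "finite L'" using inv(1) assms(1) by (rule finite_subset)
  define Z where "Z i = {l \<in> L. d \<le> card (pencil L' i (height i l))}" for i
  have Z: "card (Z i) \<le> card L' * R" if "i \<in> js" for i
  proof -
    have "card (pencil (Z i) i y) \<le> R * d" for y
      using deg[OF that, of y] card_mono[OF finite_pencil[OF assms(1)] pencil_mono, of "Z i" i y]
      by (simp add: Z_def)
    then have "real (card (pencil (Z i) i y)) \<le> real (R * d)" for y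
      by (simp only: of_nat_le_iff)
    then have "real (card (Z i)) \<le> real (card (height i ` Z i)) * real (R * d)"
      using assms(1) by (intro card_le_fibres) (auto simp: Z_def)
    then have "card (Z i) \<le> card (height i ` Z i) * (R * d)"
      by (simp only: of_nat_le_iff flip: of_nat_mult)
    also have "\<dots> = card (height i ` Z i) * d * R" by simp
    also have "\<dots> \<le> card L' * R"
      using assms(1) by (intro mult_le_mono1 card_saturated_le[OF finL']) (auto simp: Z_def)
    finally show ?thesis .
  qed
  have "L - A \<subseteq> L' \<union> (\<Union>i\<in>js. Z i)" using inv(2) by (fastforce simp: Z_def)
  then have "card (L - A) \<le> card (L' \<union> (\<Union>i\<in>js. Z i))"
    using assms(1,2) finL' by (intro card_mono) (auto simp: Z_def)
  also have "\<dots> \<le> card L' + card (\<Union>i\<in>js. Z i)" by (rule card_Un_le)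
  also have "card (\<Union>i\<in>js. Z i) \<le> (\<Sum>i\<in>js. card (Z i))" by (rule card_UN_le[OF assms(2)])
  also have "\<dots> \<le> card js * (card L' * R)"
    using sum_bounded_above[of js "\<lambda>i. card (Z i)" "card L' * R"] Z by simp
  finally show ?thesis by (simp add: algebra_simps)
qed

text \<open>Each point of \<open>Y\<close> takes at most \<open>D\<close> lines of \<open>A\<close>,
  and each of the at most \<open>mu\<close> other points takes fewer than \<theta>.\<close>

lemma card_popular_points:
  fixes D \<theta> :: real
  assumes "finite A" "height j ` A \<subseteq> {..<mu}" "\<And>y. real (card (pencil A j y)) \<le> D" "0 < \<theta>"
  defines "Y \<equiv> {y. \<theta> \<le> real (card (pencil A j y))}"
  shows "real (card A) \<le> real (card Y) * D + real mu * \<theta>"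
proof -
  have D: "0 \<le> D" using assms(3)[of 0] by linarith
  define A1 where "A1 = {l \<in> A. height j l \<in> Y}"
  define A2 where "A2 = {l \<in> A. height j l \<notin> Y}"
  have fin: "finite A1" "finite A2" using assms(1) by (simp_all add: A1_def A2_def)
  have "Y \<subseteq> height j ` A"
  proof
    fix y assume "y \<in> Y"
    then have "pencil A j y \<noteq> {}" using assms(4) by (auto simp: Y_def)
    then show "y \<in> height j ` A" by (auto simp: pencil_def)
  qed
  then have finY: "finite Y" using assms(1) finite_surj by blast
  have le: "card (pencil A1 j y) \<le> card (pencil A j y)" "card (pencil A2 j y) \<le> card (pencil A j y)" for y
    using assms(1) by (auto intro!: card_mono finite_pencil pencil_mono simp: A1_def A2_def)
  have "real (card A1) \<le> real (card (height j ` A1)) * D"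
  proof (rule card_le_fibres[OF fin(1)])
    show "real (card (pencil A1 j y)) \<le> D" for y using le(1)[of y] assms(3)[of y] by linarith
  qed
  also have "\<dots> \<le> real (card Y) * D"
    using D finY by (intro mult_right_mono) (auto intro!: card_mono simp: A1_def)
  finally have 1: "real (card A1) \<le> real (card Y) * D" .
  have "real (card (pencil A2 j y)) \<le> \<theta>" for y
  proof (cases "y \<in> Y")
    case True
    then have "pencil A2 j y = {}" by (auto simp: A2_def pencil_def)
    then show ?thesis using assms(4) by simp
  next
    case False
    then show ?thesis using le(2)[of y] by (simp add: Y_def)
  qed
  then have "real (card A2) \<le> real (card (height j ` A2)) * \<theta>"
    by (intro card_le_fibres fin)
  also have "\<dots> \<le> real mu * \<theta>"
  proof -
    have "card (height j ` A2) \<le> card {..<mu}"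
      using assms(2) by (intro card_mono) (auto simp: A2_def)
    then show ?thesis using assms(4) by (intro mult_right_mono) auto
  qed
  finally have 2: "real (card A2) \<le> real mu * \<theta>" .
  have "card A = card A1 + card A2"
    using fin by (subst card_Un_disjoint[symmetric]) (auto simp: A1_def A2_def intro: arg_cong[where f = card])
  then show ?thesis using 1 2 by simp
qed

section \<open>Passing through the columns\<close>

text \<open>With \<open>mu\<close> heights in a column and at most \<open>d\<close> lines through
  each point, \<open>mu * d\<close> is the largest possible number of lines, so \<open>b\<close>
  acts as a density.\<close>

definition spread_lines :: "real \<Rightarrow> nat \<Rightarrow> nat \<Rightarrow> nat set \<Rightarrow> line_set \<Rightarrow> bool" where
  "spread_lines b mu d js L \<longleftrightarrow> finite L \<and> (\<forall>i\<in>js. \<forall>y. card (pencil L i y) \<le> d) \<and>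
     (\<forall>i\<in>js. height i ` L \<subseteq> {..<mu}) \<and> b * real mu * real d \<le> real (card L)"

definition contains_no_line :: "nat set \<Rightarrow> line_set \<Rightarrow> (nat \<times> nat) set \<Rightarrow> bool" where
  "contains_no_line js L I \<longleftrightarrow> finite I \<and> (\<forall>l\<in>L. \<exists>i\<in>js. (i, height i l) \<notin> I)"

definition excludes :: "real \<Rightarrow> nat set \<Rightarrow> line_set \<Rightarrow> (nat \<times> nat) set \<Rightarrow> (nat \<times> nat) set \<Rightarrow> bool" where
  "excludes c js L I W \<longleftrightarrow>
     W \<subseteq> (\<Union>i\<in>js. Pair i ` height i ` L) \<and> W \<inter> I = {} \<and> c \<le> real (card W)"

text \<open>Induction on the number of columns, with \<open>f\<close> greedy picks in each but the
  last. If many lines \<open>L'\<close> were collected, all their points in this column are in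
  \<open>I\<close>, so each must miss \<open>I\<close> in a remaining column, and the argument
  recurses with the maximal degree smaller by a factor \<open>R\<close>. Otherwise most lines are
  still available, and the points carrying many of them are excluded.\<close>

lemma columns_fingerprint:
  fixes b :: real
  assumes "1 \<le> R" "mu \<le> f * R" "card js = Suc r" "Suc r \<le> k" "0 < b"
  shows "\<exists>W. determined (r * f) W \<and> (spread_lines b mu (R ^ r) js L \<longrightarrow>
    (\<forall>I. contains_no_line js L I \<longrightarrow> excludes (b / real (4 * k) ^ r / 4 * real mu) js L I (W I)))"
  using assms(3-5)
proof (induction r arbitrary: L js b)
  case 0
  \<comment> \<open>With a single column every line misses \<open>I\<close> there, so all its points
    on lines of \<open>L\<close> are excluded. As the degree is at most \<open>R ^ 0\<close>, there
    are as many of them as lines.\<close>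
  let ?W = "\<Union>i\<in>js. Pair i ` height i ` L"
  obtain i where i: "js = {i}" using 0(1) by (metis One_nat_def card_1_singletonE)
  have "excludes (b / real (4 * k) ^ 0 / 4 * real mu) js L I ?W"
    if L: "spread_lines b mu (R ^ 0) js L" and I: "contains_no_line js L I" for I
    unfolding excludes_def
  proof (intro conjI)
    show "?W \<inter> I = {}" using I by (auto simp: i contains_no_line_def)
    have "real (card L) \<le> real (card (height i ` L)) * 1"
      using L by (intro card_le_fibres) (auto simp: i spread_lines_def)
    moreover have "card ?W = card (height i ` L)" by (simp add: i card_image inj_on_def)
    moreover have "0 \<le> b * real mu" using 0(3) by simp
    ultimately show "b / real (4 * k) ^ 0 / 4 * real mu \<le> real (card ?W)"
      using L by (simp add: spread_lines_def)
  qed simp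
  then show ?case by (intro exI[of _ "\<lambda>_. ?W"] conjI impI allI determined_const)
next
  case (Suc r)
  note cjs = Suc.prems(1) and k = Suc.prems(2) and b = Suc.prems(3)
  show ?case
  proof (cases "spread_lines b mu (R ^ Suc r) js L")
    case False
    then show ?thesis
      using determined_const by (intro exI[of _ "\<lambda>_. {}"]) simp
  next
    case True
    then have finL: "finite L"
      and deg: "\<And>i y. i \<in> js \<Longrightarrow> card (pencil L i y) \<le> R ^ Suc r"
      and ht: "\<And>i. i \<in> js \<Longrightarrow> height i ` L \<subseteq> {..<mu}"
      and big: "b * real mu * real R ^ Suc r \<le> real (card L)"
      unfolding spread_lines_def by auto
    obtain j js' where js: "js = insert j js'" "j \<notin> js'" "card js' = Suc r"
      using cjs by (metis card_Suc_eq)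
    have finjs': "finite js'" using js(3) by (simp add: card_ge_0_finite)
    define x where "x I = ((\<lambda>x. greedy_step js' (R ^ r) j x I) ^^ f) (L, {})" for I
    \<comment> \<open>The factor \<open>4 * k\<close> is chosen so that, if \<open>L'\<close> stays
      below density \<open>b'\<close>, the loss of at most \<open>card L' * (k * R)\<close> lines is
      at most a quarter of those that density \<open>b\<close> guarantees.\<close>
    define b' where "b' = b / real (4 * k)"
    define \<theta> where "\<theta> = b * real R ^ Suc r / 2"
    have b': "0 < b'" using b k by (simp add: b'_def)
    \<comment> \<open>The set \<open>L'\<close> will depend on \<open>I\<close>, so a map
      \<open>V L'\<close> with a bounded fingerprint is chosen for every \<open>L'\<close>, spread
      or not.\<close>
    have "\<forall>L'. \<exists>W. determined (r * f) W \<and> (spread_lines b' mu (R ^ r) js' L' \<longrightarrow>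
      (\<forall>I. contains_no_line js' L' I \<longrightarrow>
         excludes (b' / real (4 * k) ^ r / 4 * real mu) js' L' I (W I)))"
      using Suc.IH[OF js(3) _ b'] k by simp
    from choice[OF this] obtain V where detV: "\<And>L'. determined (r * f) (V L')"
      and V: "\<And>L' I. spread_lines b' mu (R ^ r) js' L' \<Longrightarrow> contains_no_line js' L' I \<Longrightarrow>
         excludes (b' / real (4 * k) ^ r / 4 * real mu) js' L' I (V L' I)"
      by metis
    define Y where "Y A = {y. \<theta> \<le> real (card (pencil A j y))}" for A
    define B where "B = (\<lambda>(A, L'). if b' * real mu * real R ^ r \<le> real (card L') then V L'
      else (\<lambda>_. Pair j ` Y A))"
    have detB: "determined (r * f) (B a)" for a
      by (cases a) (simp add: B_def detV determined_const)
    have "determined f x"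
      unfolding x_def by (intro determined_funpow determined_greedy_step)
    then have "determined (f + r * f) (\<lambda>I. B (x I) I)"
      by (rule determined_bind) (rule detB)
    moreover have "excludes (b / real (4 * k) ^ Suc r / 4 * real mu) js L I (B (x I) I)"
      if noline: "contains_no_line js L I" for I
    proof -
      have finI: "finite I" and free: "\<forall>l\<in>L. \<exists>i\<in>js. (i, height i l) \<notin> I"
        using noline by (simp_all add: contains_no_line_def)
      obtain A L' where xI: "x I = (A, L')" by fastforce
      have R0: "0 < R ^ r" using assms(1) by simp
      have inv: "greedy_inv js' (R ^ r) j L I f (A, L')"
        using greedy_inv_run[OF finL finI js(2) R0, of f] unfolding xI[symmetric] x_def .
      then have AL: "A \<subseteq> L" "L' \<subseteq> L" "\<And>i y. i \<in> js' \<Longrightarrow> card (pencil L' i y) \<le> R ^ r"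
        "\<And>l. l \<in> L' \<Longrightarrow> (j, height j l) \<in> I"
        "\<And>y. (j, y) \<in> I \<Longrightarrow> f * card (pencil A j y) \<le> card L'"
        unfolding greedy_inv_def by simp_all
      have finA: "finite A" and finL': "finite L'" using AL(1,2) finL finite_subset by blast+
      have k0: "0 < real k" using k by simp
      show ?thesis
      proof (cases "b' * real mu * real R ^ r \<le> real (card L')")
        case True
        have "spread_lines b' mu (R ^ r) js' L'"
          unfolding spread_lines_def
        proof (intro conjI ballI allI)
          show "height i ` L' \<subseteq> {..<mu}" if "i \<in> js'" for i using ht[of i] that AL(2) js(1) by auto
        qed (use finL' AL(3) True in simp_all)
        moreover have "contains_no_line js' L' I"
          unfolding contains_no_line_def
        proof (intro conjI ballI finI)
          show "\<exists>i\<in>js'. (i, height i l) \<notin> I" if "l \<in> L'" for l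
            using free AL(2) AL(4)[OF that] that js(1) by blast
        qed
        ultimately have "excludes (b' / real (4 * k) ^ r / 4 * real mu) js' L' I (V L' I)" by (rule V)
        moreover have "(\<Union>i\<in>js'. Pair i ` height i ` L') \<subseteq> (\<Union>i\<in>js. Pair i ` height i ` L)"
          using AL(2) js(1) by (intro UN_mono image_mono) auto
        ultimately show ?thesis using True by (simp add: xI B_def b'_def excludes_def) (blast | argo)
      next
        case False
        then have small: "real (card L') < b' * real mu * real R ^ r" by simp
        have \<theta>: "0 < \<theta>" using b assms(1) by (simp add: \<theta>_def)
        have sub: "Y A \<subseteq> height j ` L"
        proof
          fix y assume "y \<in> Y A"
          then have "pencil A j y \<noteq> {}" using \<theta> by (auto simp: Y_def)
          then show "y \<in> height j ` L" using AL(1) by (auto simp: pencil_def)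
        qed
        \<comment> \<open>A popular point left in \<open>I\<close> would mean that all \<open>f\<close> picks were popular, so \<open>L'\<close> would be large.\<close>
        have disj: "(j, y) \<notin> I" if "y \<in> Y A" for y
        proof
          assume "(j, y) \<in> I"
          from AL(5)[OF this] have "real f * real (card (pencil A j y)) \<le> real (card L')"
            by (simp flip: of_nat_mult)
          moreover have "real f * \<theta> \<le> real f * real (card (pencil A j y))"
            using that by (intro mult_left_mono) (simp_all add: Y_def)
          moreover have "b' * real mu * real R ^ r \<le> real f * \<theta>"
          proof -
            have "real mu \<le> real f * real R" using assms(2) by (simp flip: of_nat_mult)
            then have "real mu * (b * real R ^ r / 2) \<le> real f * real R * (b * real R ^ r / 2)"
              using b by (intro mult_right_mono) simp_all
            moreover have "b' \<le> b / 2" using b k by (simp add: b'_def field_simps)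
            then have "b' * (real mu * real R ^ r) \<le> b / 2 * (real mu * real R ^ r)"
              by (intro mult_right_mono) simp_all
            ultimately show ?thesis by (simp add: \<theta>_def algebra_simps)
          qed
          ultimately show False using small by linarith
        qed
        have "card (L - A) \<le> card L' * (1 + card js' * R)"
          using deg js(1) by (intro greedy_inv_card_removed[OF finL finjs' R0 inv]) simp
        also have "\<dots> \<le> card L' * (k * R)"
        proof (intro mult_le_mono2)
          have "1 + card js' * R \<le> R + card js' * R" using assms(1) by simp
          also have "\<dots> = Suc (Suc r) * R" by (simp add: js(3))
          also have "\<dots> \<le> k * R" using k by (intro mult_le_mono1)
          finally show "1 + card js' * R \<le> k * R" .
        qed
        finally have "real (card (L - A)) \<le> real (card L') * (real k * real R)"
          by (simp flip: of_nat_mult)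
        also have "\<dots> \<le> b' * real mu * real R ^ r * (real k * real R)"
          using small by (intro mult_right_mono) simp_all
        also have "\<dots> = b * real mu * real R ^ Suc r / 4"
          using k0 by (simp add: b'_def)
        finally have 1: "real (card (L - A)) \<le> b * real mu * real R ^ Suc r / 4" .
        have 2: "real (card L) = real (card (L - A)) + real (card A)"
          using card_Diff_subset[OF finA AL(1)] card_mono[OF finL AL(1)] by simp
        have "card (pencil A j y) \<le> R ^ Suc r" for y
          using deg[of j y] js(1) card_mono[OF finite_pencil[OF finL] pencil_mono[OF AL(1)], of j y]
          by simp
        then have "real (card (pencil A j y)) \<le> real R ^ Suc r" for y
          by (metis of_nat_le_iff of_nat_power)
        moreover have "height j ` A \<subseteq> {..<mu}" using ht[of j] js(1) AL(1) by auto
        ultimately have 3: "real (card A) \<le> real (card (Y A)) * real R ^ Suc r + real mu * \<theta>"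
          unfolding Y_def by (intro card_popular_points finA \<theta>)
        \<comment> \<open>Of the guaranteed \<open>b * mu * R ^ Suc r\<close> lines, at most a
          quarter were removed and at most half lie on unpopular points; the remaining quarter needs
          \<open>b * mu / 4\<close> popular points.\<close>
        have "b * real mu / 4 * real R ^ Suc r \<le> real (card (Y A)) * real R ^ Suc r"
          using 1 2 3 big by (simp add: \<theta>_def field_simps)
        then have "b * real mu / 4 \<le> real (card (Y A))"
          using assms(1) by (simp only: mult_le_cancel_right) (simp split: if_splits)
        moreover have "b / real (4 * k) ^ Suc r / 4 * real mu \<le> b * real mu / 4"
        proof -
          have "1 \<le> real (4 * k) ^ Suc r" using k by (intro one_le_power) simp
          then have "b / real (4 * k) ^ Suc r \<le> b / 1"
            using b by (intro divide_left_mono) linarith+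
          then have "b / real (4 * k) ^ Suc r * (real mu / 4) \<le> b / 1 * (real mu / 4)"
            by (intro mult_right_mono) simp_all
          then show ?thesis by simp
        qed
        moreover have "card (Pair j ` Y A) = card (Y A)" by (simp add: card_image inj_on_def)
        ultimately have "b / real (4 * k) ^ Suc r / 4 * real mu \<le> real (card (Pair j ` Y A))"
          by linarith
        moreover have "B (x I) I = Pair j ` Y A" using False by (simp add: xI B_def)
        moreover have "Pair j ` Y A \<subseteq> (\<Union>i\<in>js. Pair i ` height i ` L)" using sub js(1) by auto
        moreover have "Pair j ` Y A \<inter> I = {}" using disj by auto
        ultimately show ?thesis unfolding excludes_def by metis
      qed
    qed
    ultimately show ?thesis by (intro exI[of _ "\<lambda>I. B (x I) I"] conjI impI allI) simp_all
  qed
qed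

section \<open>Supersaturation and containers\<close>

abbreviation line_family :: "nat \<Rightarrow> nat \<Rightarrow> line_set" where
  "line_family q m \<equiv> {..<q} \<times> {..<m}"

lemma height_less:
  assumes "l \<in> line_family q m" "j < M"
  shows "height j l < m + M * q"
proof -
  have "fst l * j \<le> q * M" using assms by (intro mult_le_mono) auto
  then show ?thesis using assms by (auto simp: height_def mult.commute)
qed

lemma card_pencil_line_family_le: "card (pencil (line_family q m) j y) \<le> q"
proof -
  have "inj_on fst (pencil (line_family q m) j y)"
    by (auto simp: inj_on_def pencil_def height_def)
  then have "card (pencil (line_family q m) j y) = card (fst ` pencil (line_family q m) j y)"
    by (rule card_image[symmetric])
  also have "\<dots> \<le> card {..<q}" by (intro card_mono) (auto simp: pencil_def)
  finally show ?thesis by simp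
qed

text \<open>Each slope \<open>a < q\<close> yields a line through the point, with intercept
  \<open>y - a * j\<close>. The lower bound on \<open>y\<close> keeps this subtraction from
  truncating, and \<open>y < m\<close> keeps the intercept in range.\<close>

lemma card_pencil_line_family_ge:
  assumes "j < M" "M * q \<le> y" "y < m"
  shows "q \<le> card (pencil (line_family q m) j y)"
proof -
  have le: "a * j \<le> y" if "a < q" for a
    using mult_le_mono[of a q j M] that assms by (simp add: mult.commute)
  have "card ((\<lambda>a. (a, y - a * j)) ` {..<q}) \<le> card (pencil (line_family q m) j y)"
    using assms le by (intro card_mono) (auto simp: pencil_def height_def)
  then show ?thesis by (simp add: card_image inj_on_def)
qed

lemma sum_incidences:
  assumes "finite L" "finite C" "C \<subseteq> {..<M} \<times> UNIV"
  shows "(\<Sum>l\<in>L. card {j\<in>{..<M}. (j, height j l) \<in> C}) = (\<Sum>(j, y)\<in>C. card (pencil L j y))"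
proof -
  have "card {j\<in>{..<M}. (j, height j l) \<in> C} = (\<Sum>(j, y)\<in>C. if height j l = y then 1 else 0)" for l
  proof -
    have "card {j\<in>{..<M}. (j, height j l) \<in> C} = card ((\<lambda>j. (j, height j l)) ` {j\<in>{..<M}. (j, height j l) \<in> C})"
      by (rule card_image[symmetric]) (simp add: inj_on_def)
    also have "(\<lambda>j. (j, height j l)) ` {j\<in>{..<M}. (j, height j l) \<in> C} = {p \<in> C. height (fst p) l = snd p}"
      using assms(3) by force
    also have "card \<dots> = (\<Sum>p\<in>C. if height (fst p) l = snd p then 1 else 0)"
      using assms(2) by (simp add: sum.If_cases Int_def)
    finally show ?thesis by (simp add: case_prod_beta)
  qed
  then have "(\<Sum>l\<in>L. card {j\<in>{..<M}. (j, height j l) \<in> C}) =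
      (\<Sum>l\<in>L. \<Sum>p\<in>C. if height (fst p) l = snd p then 1 else 0)"
    by (simp add: case_prod_beta)
  also have "\<dots> = (\<Sum>p\<in>C. \<Sum>l\<in>L. if height (fst p) l = snd p then 1 else 0)" by (rule sum.swap)
  also have "\<dots> = (\<Sum>p\<in>C. card (pencil L (fst p) (snd p)))"
    using assms(1) by (simp add: sum.If_cases Int_def pencil_def)
  finally show ?thesis by (simp add: case_prod_beta)
qed

text \<open>Supersaturation by double counting: points of \<open>C\<close> away from top and bottom
  have full degree \<open>q\<close>, so many lines meet \<open>C\<close> in at least
  \<open>k\<close> columns. By pigeonhole, some set of \<open>k\<close> columns serves a proportion
  of at least \<open>1 / 2 ^ M\<close> of these lines.\<close>

lemma dense_set_has_popular_columns:
  fixes a :: real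
  assumes C: "C \<subseteq> {..<M} \<times> {..<mu}" "a * real M * real mu \<le> real (card C)"
    and mu: "mu = m + M * q" "4 * real M * real q \<le> a * real mu"
    and k: "4 * real k \<le> a * real M" and M: "0 < M" and a: "a \<le> 1"
  shows "\<exists>J\<subseteq>{..<M}. card J = k \<and>
    a / 4 / 2 ^ M * real mu * real q \<le> real (card {l \<in> line_family q m. \<forall>j\<in>J. (j, height j l) \<in> C})"
proof -
  let ?F = "line_family q m"
  define N where "N l = card {j\<in>{..<M}. (j, height j l) \<in> C}" for l
  define rich where "rich = {l \<in> ?F. k \<le> N l}"
  have finC: "finite C" using C(1) finite_subset by blast
  \<comment> \<open>The discarded strips contain \<open>2 * M * q\<close> heights per column, at
    most half of the guaranteed number of points.\<close>
  define C' where "C' = {(j, y) \<in> C. M * q \<le> y \<and> y < m}"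
  have sub: "C' \<subseteq> C" by (auto simp: C'_def)
  have "C - C' \<subseteq> {..<M} \<times> ({..<M * q} \<union> {m..<mu})"
    using C(1) by (auto simp: C'_def)
  then have "card (C - C') \<le> card ({..<M} \<times> ({..<M * q} \<union> {m..<mu}))" by (intro card_mono) auto
  also have "\<dots> = M * card ({..<M * q} \<union> {m..<mu})" by (simp only: card_cartesian_product card_lessThan)
  also have "\<dots> \<le> M * (M * q + M * q)"
    using card_Un_le[of "{..<M * q}" "{m..<mu}"] by (intro mult_le_mono2) (simp add: mu(1))
  finally have "real (card (C - C')) \<le> real (M * (M * q + M * q))" by (simp only: of_nat_le_iff)
  also have "\<dots> = real M * (4 * real M * real q) / 2" by simp
  also have "\<dots> \<le> real M * (a * real mu) / 2" using mu(2) by (intro divide_right_mono mult_left_mono) auto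
  finally have "real (card (C - C')) \<le> a * real M * real mu / 2" by (simp add: algebra_simps)
  moreover have "card C = card (C - C') + card C'"
    using card_Diff_subset[OF finite_subset[OF sub finC] sub] card_mono[OF finC sub] by simp
  ultimately have C': "a * real M * real mu / 2 \<le> real (card C')" using C(2) by linarith
  have "(\<Sum>l\<in>?F. N l) = (\<Sum>(j, y)\<in>C. card (pencil ?F j y))"
    unfolding N_def using C(1) finC by (intro sum_incidences) auto
  also have "\<dots> \<ge> (\<Sum>(j, y)\<in>C'. card (pencil ?F j y))"
    using finC by (intro sum_mono2) (auto simp: C'_def)
  moreover have "(\<Sum>(j, y)\<in>C'. card (pencil ?F j y)) \<ge> (\<Sum>(j, y)\<in>C'. q)"
    using C(1) by (intro sum_mono) (auto simp: C'_def intro!: card_pencil_line_family_ge[where M = M])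
  ultimately have low: "card C' * q \<le> (\<Sum>l\<in>?F. N l)" by simp
  have "N l \<le> M" for l
    unfolding N_def by (rule order_trans[OF card_mono[of "{..<M}"]]) auto
  \<comment> \<open>A rich line has at most \<open>M\<close> incidences and any other fewer than
    \<open>k\<close>; the latter account for at most half of the lower bound
    \<open>a * M * mu * q / 2\<close> on the sum.\<close>
  then have "(\<Sum>l\<in>?F. N l) \<le> (\<Sum>l\<in>?F. (if l \<in> rich then M else 0) + k)"
    by (intro sum_mono) (auto simp: rich_def trans_le_add1)
  also have "\<dots> = card rich * M + q * m * k"
    by (simp add: sum.distrib sum.If_cases rich_def Int_def)
  finally have "card C' * q \<le> card rich * M + q * m * k" using low by linarith
  then have "real (card C') * real q \<le> real (card rich) * real M + real q * real m * real k"
    by (simp flip: of_nat_mult of_nat_add)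
  moreover have "real q * real m * real k \<le> real q * real mu * (a * real M / 4)"
    using k by (intro mult_mono) (auto simp: mu(1))
  moreover have "a * real M * real mu / 2 * real q \<le> real (card C') * real q"
    using C' by (intro mult_right_mono) auto
  ultimately have "a / 4 * real mu * real q * real M \<le> real (card rich) * real M"
    by (simp add: algebra_simps)
  then have rich: "a / 4 * real mu * real q \<le> real (card rich)" using M by simp
  define JJ where "JJ = {J. J \<subseteq> {..<M} \<and> card J = k}"
  define G where "G J = {l \<in> ?F. \<forall>j\<in>J. (j, height j l) \<in> C}" for J
  have finJJ: "finite JJ" by (simp add: JJ_def)
  have "card JJ \<le> card (Pow {..<M})" unfolding JJ_def by (intro card_mono) auto
  then have cJJ: "card JJ \<le> 2 ^ M" by (simp add: card_Pow)
  have "rich \<subseteq> (\<Union>J\<in>JJ. G J)"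
  proof
    fix l assume l: "l \<in> rich"
    then have "k \<le> card {j\<in>{..<M}. (j, height j l) \<in> C}" by (simp add: rich_def N_def)
    then obtain J where "J \<subseteq> {j\<in>{..<M}. (j, height j l) \<in> C}" "card J = k"
      by (meson obtain_subset_with_card_n)
    then have "J \<in> JJ" "l \<in> G J" using l by (auto simp: JJ_def G_def rich_def)
    then show "l \<in> (\<Union>J\<in>JJ. G J)" by blast
  qed
  then have "card rich \<le> card (\<Union>J\<in>JJ. G J)" using finJJ by (intro card_mono) (auto simp: G_def)
  also have "\<dots> \<le> (\<Sum>J\<in>JJ. card (G J))" by (rule card_UN_le[OF finJJ])
  finally have sum: "card rich \<le> (\<Sum>J\<in>JJ. card (G J))" .
  have "a * real M \<le> 1 * real M" using a by (intro mult_right_mono) auto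
  then have "k \<le> M" using k by simp
  then have "{..<k} \<in> JJ" by (auto simp: JJ_def)
  then have "Max ((card \<circ> G) ` JJ) \<in> (card \<circ> G) ` JJ" using finJJ by (intro Max_in) auto
  then obtain J where J: "J \<in> JJ" "card (G J) = Max ((card \<circ> G) ` JJ)" by auto
  have "card (G J') \<le> card (G J)" if "J' \<in> JJ" for J'
    using finJJ that unfolding J(2) by (intro Max_ge) auto
  then have "(\<Sum>J\<in>JJ. card (G J)) \<le> card JJ * card (G J)"
    using sum_bounded_above[of JJ "\<lambda>J. card (G J)" "card (G J)"] by simp
  also have "\<dots> \<le> 2 ^ M * card (G J)" using cJJ by (intro mult_le_mono1)
  finally have "real (card rich) \<le> real (2 ^ M * card (G J))" using sum by (simp only: of_nat_le_iff)
  then have "a / 4 * real mu * real q \<le> 2 ^ M * real (card (G J))" using rich by simp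
  then have "a / 4 / 2 ^ M * real mu * real q \<le> real (card (G J))" by (simp add: field_simps)
  then show ?thesis using J(1) unfolding JJ_def G_def by blast
qed


section \<open>Containers for line-free sets in the grid\<close>

definition line_free :: "nat \<Rightarrow> line_set \<Rightarrow> (nat \<times> nat) set \<Rightarrow> bool" where
  "line_free k L I \<longleftrightarrow> (\<forall>l\<in>L. card {j. (j, height j l) \<in> I} < k)"

text \<open>There are \<open>R ^ (k - 1)\<close> slopes, so that after \<open>k - 1\<close> columns,
  each reducing the maximal degree by a factor \<open>R\<close>, the last one has degree at most 1.
  The number of picks per column is \<open>f\<close>, and \<open>a\<close> is the density at which
  shrinking stops.\<close>

locale grid =
  fixes k M R f m mu :: nat and a :: real
  assumes k: "1 \<le> k" and R: "1 \<le> R" and f: "mu \<le> f * R" and mu: "mu = m + M * R ^ (k - 1)"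
    and a: "0 < a" "a \<le> 1" and M: "4 * real k \<le> a * real M"
    and margin: "4 * real M * real (R ^ (k - 1)) \<le> a * real mu"
begin

abbreviation lines :: line_set where
  "lines \<equiv> line_family (R ^ (k - 1)) m"

abbreviation points :: "(nat \<times> nat) set" where
  "points \<equiv> {..<M} \<times> {..<mu}"

text \<open>This is the bound of \<open>columns_fingerprint\<close>, relative to \<open>mu\<close>,
  for the line density \<open>a / 4 / 2 ^ M\<close> supplied by supersaturation.\<close>

definition decrement :: real where
  "decrement = a / 4 / 2 ^ M / real (4 * k) ^ (k - 1) / 4"

lemma M_pos: "0 < M"
proof (rule ccontr)
  assume "\<not> 0 < M"
  then show False using M k by simp
qed

lemma decrement_pos: "0 < decrement"
  using a k by (simp add: decrement_def)

text \<open>No line that is full on the \<open>k\<close> popular columns of \<open>C\<close> has all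
  these \<open>k\<close> points in a line-free \<open>I\<close>. So
  \<open>columns_fingerprint\<close> applies, and the excluded set is deleted from
  \<open>C\<close>.\<close>

lemma container_step:
  assumes C: "C \<subseteq> points" "a * real M * real mu \<le> real (card C)"
  shows "\<exists>A. determined ((k - 1) * f) A \<and> (\<forall>I\<subseteq>C. line_free k lines I \<longrightarrow>
    I \<subseteq> A I \<and> A I \<subseteq> C \<and> real (card (A I)) \<le> real (card C) - decrement * real mu)"
proof -
  obtain J where J: "J \<subseteq> {..<M}" "card J = k" and
    big: "a / 4 / 2 ^ M * real mu * real (R ^ (k - 1)) \<le>
      real (card {l \<in> lines. \<forall>j\<in>J. (j, height j l) \<in> C})"
    using dense_set_has_popular_columns[OF C mu margin M M_pos a(2)] by blast
  define L where "L = {l \<in> lines. \<forall>j\<in>J. (j, height j l) \<in> C}"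
  have finL: "finite L" by (simp add: L_def)
  have "card J = Suc (k - 1)" "Suc (k - 1) \<le> k" "0 < a / 4 / 2 ^ M" using J k a by auto
  from columns_fingerprint[OF R f this, of L] obtain W where W: "determined ((k - 1) * f) W"
    "spread_lines (a / 4 / 2 ^ M) mu (R ^ (k - 1)) J L \<Longrightarrow> contains_no_line J L I \<Longrightarrow>
       excludes (decrement * real mu) J L I (W I)" for I
    unfolding decrement_def by metis
  have spread: "spread_lines (a / 4 / 2 ^ M) mu (R ^ (k - 1)) J L"
    unfolding spread_lines_def
  proof (intro conjI ballI allI finL)
    fix i y
    have "card (pencil L i y) \<le> card (pencil lines i y)"
      by (intro card_mono pencil_mono finite_pencil) (auto simp: L_def)
    then show "card (pencil L i y) \<le> R ^ (k - 1)"
      using card_pencil_line_family_le order_trans by blast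
  next
    show "height i ` L \<subseteq> {..<mu}" if "i \<in> J" for i
      using that J(1) unfolding mu L_def by (auto intro!: height_less)
  qed (use big in \<open>simp add: L_def\<close>)
  have finC: "finite C" using C(1) finite_subset by blast
  have "determined ((k - 1) * f) (\<lambda>I. C - W I)"
    using determined_bind[OF W(1) determined_const[of 0], of "\<lambda>X. C - X"] by simp
  moreover have "I \<subseteq> C - W I \<and> C - W I \<subseteq> C \<and>
      real (card (C - W I)) \<le> real (card C) - decrement * real mu"
    if I: "I \<subseteq> C" "line_free k lines I" for I
  proof -
    have finI: "finite I" using I(1) finC by (rule finite_subset)
    have "contains_no_line J L I"
      unfolding contains_no_line_def
    proof (intro conjI ballI finI)
      fix l assume l: "l \<in> L"
      show "\<exists>i\<in>J. (i, height i l) \<notin> I"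
      proof (rule ccontr)
        assume "\<not> ?thesis"
        then have "J \<subseteq> {j. (j, height j l) \<in> I}" by auto
        moreover have "finite {j. (j, height j l) \<in> I}"
          by (rule finite_subset[of _ "fst ` I"]) (use finI in force)+
        ultimately have "card J \<le> card {j. (j, height j l) \<in> I}" by (intro card_mono)
        moreover have "l \<in> lines" using l by (simp add: L_def)
        then have "card {j. (j, height j l) \<in> I} < k" using I(2) unfolding line_free_def by (rule bspec[rotated])
        ultimately show False using J(2) by simp
      qed
    qed
    from W(2)[OF spread this] have X: "W I \<subseteq> (\<Union>i\<in>J. Pair i ` height i ` L)" "W I \<inter> I = {}"
      "decrement * real mu \<le> real (card (W I))" by (auto simp: excludes_def)
    have WC: "W I \<subseteq> C" using X(1) by (auto simp: L_def)
    then have "card (C - W I) = card C - card (W I)" "card (W I) \<le> card C"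
      using finC by (auto intro: card_Diff_subset finite_subset card_mono)
    then show ?thesis using X(2,3) I(1) by auto
  qed
  ultimately show ?thesis by (intro exI[of _ "\<lambda>I. C - W I"]) simp
qed

text \<open>Each round removes at least \<open>decrement * mu\<close> points while the density is at
  least \<open>a\<close>; a container already below that is kept, whence the maximum.\<close>

lemma container_iterate:
  "\<exists>A. determined (n * ((k - 1) * f)) A \<and> (\<forall>I\<subseteq>points. line_free k lines I \<longrightarrow>
    I \<subseteq> A I \<and> A I \<subseteq> points \<and>
    real (card (A I)) \<le> max (a * real M * real mu) (real M * real mu - real n * decrement * real mu))"
proof (induction n)
  case 0
  show ?case
    by (intro exI[of _ "\<lambda>_. points"]) (simp add: determined_const)
next
  case (Suc n)
  let ?b = "\<lambda>n. max (a * real M * real mu) (real M * real mu - real n * decrement * real mu)"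
  obtain A where A: "determined (n * ((k - 1) * f)) A"
    "\<And>I. I \<subseteq> points \<Longrightarrow> line_free k lines I \<Longrightarrow> I \<subseteq> A I \<and> A I \<subseteq> points \<and> real (card (A I)) \<le> ?b n"
    using Suc by metis
  have "\<exists>B. determined ((k - 1) * f) B \<and> (C \<subseteq> points \<longrightarrow> (\<forall>I\<subseteq>C. line_free k lines I \<longrightarrow>
    I \<subseteq> B I \<and> B I \<subseteq> C \<and>
    real (card (B I)) \<le> max (a * real M * real mu) (real (card C) - decrement * real mu)))" for C
  proof (cases "C \<subseteq> points \<and> a * real M * real mu \<le> real (card C)")
    case True
    then show ?thesis using container_step[of C] by (meson max.coboundedI2)
  next
    case False
    then show ?thesis by (intro exI[of _ "\<lambda>_. C"]) (auto simp: determined_const)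
  qed
  then obtain B where B: "\<And>C. determined ((k - 1) * f) (B C)"
    "\<And>C I. C \<subseteq> points \<Longrightarrow> I \<subseteq> C \<Longrightarrow> line_free k lines I \<Longrightarrow> I \<subseteq> B C I \<and> B C I \<subseteq> C \<and>
      real (card (B C I)) \<le> max (a * real M * real mu) (real (card C) - decrement * real mu)"
    by metis
  have "determined (Suc n * ((k - 1) * f)) (\<lambda>I. B (A I) I)"
    using determined_bind[OF A(1) B(1)] by (simp add: add.commute)
  moreover have "I \<subseteq> B (A I) I \<and> B (A I) I \<subseteq> points \<and> real (card (B (A I) I)) \<le> ?b (Suc n)"
    if "I \<subseteq> points" "line_free k lines I" for I
  proof -
    note 1 = A(2)[OF that]
    have 2: "I \<subseteq> B (A I) I \<and> B (A I) I \<subseteq> A I \<and>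
      real (card (B (A I) I)) \<le> max (a * real M * real mu) (real (card (A I)) - decrement * real mu)"
      using 1 that(2) by (intro B(2)) auto
    have "0 \<le> decrement * real mu" using decrement_pos by simp
    then have "max (a * real M * real mu) (real (card (A I)) - decrement * real mu) \<le> ?b (Suc n)"
      using 1 by (auto simp: max_def algebra_simps split: if_splits)
    then show ?thesis using 1 2 by (meson order_trans subset_trans)
  qed
  ultimately show ?case by (intro exI[of _ "\<lambda>I. B (A I) I"]) simp
qed

text \<open>As \<open>A F = A I\<close> for the fingerprint \<open>F\<close> of \<open>I\<close>,
  the container is a function of \<open>F\<close>. The \<open>n\<close> rounds suffice to exhaust
  all \<open>M * mu\<close> points, so the density must have dropped to \<open>a\<close>.\<close>

theorem containers:
  assumes "real M \<le> real n * decrement"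
  shows "\<exists>G. (\<forall>F. G F \<subseteq> points \<and> real (card (G F)) \<le> a * real M * real mu) \<and>
    (\<forall>I\<subseteq>points. line_free k lines I \<longrightarrow> (\<exists>F\<subseteq>I. card F \<le> n * ((k - 1) * f) \<and> I \<subseteq> G F))"
proof -
  obtain A where A: "determined (n * ((k - 1) * f)) A"
    "\<And>I. I \<subseteq> points \<Longrightarrow> line_free k lines I \<Longrightarrow> I \<subseteq> A I \<and> A I \<subseteq> points \<and>
      real (card (A I)) \<le> max (a * real M * real mu) (real M * real mu - real n * decrement * real mu)"
    using container_iterate[of n] by metis
  have "real M * real mu \<le> real n * decrement * real mu" using assms by (intro mult_right_mono) auto
  moreover have "0 \<le> a * real M * real mu" using a by simp
  ultimately have "max (a * real M * real mu) (real M * real mu - real n * decrement * real mu) = a * real M * real mu"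
    by simp
  with A(2) have A2: "I \<subseteq> A I \<and> A I \<subseteq> points \<and> real (card (A I)) \<le> a * real M * real mu"
    if "I \<subseteq> points" "line_free k lines I" for I using that by metis
  \<comment> \<open>The default \<open>{}\<close> makes the bounds hold for every \<open>F\<close>,
    as the union bound over samples requires.\<close>
  define G where "G F = (if A F \<subseteq> points \<and> real (card (A F)) \<le> a * real M * real mu then A F else {})" for F
  have "\<exists>F\<subseteq>I. card F \<le> n * ((k - 1) * f) \<and> I \<subseteq> G F" if I: "I \<subseteq> points" "line_free k lines I" for I
  proof -
    have "finite I" using I(1) finite_subset by blast
    then obtain F where F: "F \<subseteq> I" "card F \<le> n * ((k - 1) * f)" "A F = A I"
      using A(1) unfolding determined_def by (metis order_refl)
    then have "I \<subseteq> G F" using A2[OF I] by (simp add: G_def)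
    then show ?thesis using F by blast
  qed
  moreover have "G F \<subseteq> points \<and> real (card (G F)) \<le> a * real M * real mu" for F
    using \<open>0 \<le> a * real M * real mu\<close> by (auto simp: G_def)
  ultimately show ?thesis by (intro exI[of _ G]) blast
qed

end

section \<open>Sparse random samples\<close>

text \<open>
  Samples are functions \<open>h\<close> on \<open>{..<s}\<close>, counted rather than weighted. Conditioned on the values on
  \<open>J\<close>, those on \<open>K\<close> are still uniform.
\<close>
lemma card_adaptive_event_le:
  fixes G :: "'p set \<Rightarrow> 'p set" and c :: real
  assumes fin: "finite P" and JK: "J \<subseteq> {..<s}" "K \<subseteq> {..<s}" "J \<inter> K = {}"
    and G: "\<And>F. G F \<subseteq> P" "\<And>F. real (card (G F)) \<le> c"
  shows "real (card {h \<in> {..<s} \<rightarrow>\<^sub>E P. \<forall>i\<in>K. h i \<in> G (h ` J)}) \<le> c ^ card K * real (card P) ^ (s - card K)"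
proof -
  \<comment> \<open>Once \<open>u\<close> prescribes the values on \<open>J\<close>, the target set
    for \<open>K\<close> is fixed and the remaining choices form a product.\<close>
  define X where "X u = PiE {..<s} (\<lambda>i. if i \<in> J then {u i} else if i \<in> K then G (u ` J) else P)" for u
  have finJK: "finite J" "finite K" using JK finite_subset by blast+
  have finX: "finite (X u)" if "u \<in> J \<rightarrow>\<^sub>E P" for u
    unfolding X_def using fin finite_subset[OF G(1) fin] by (intro finite_PiE) auto
  have "{h \<in> {..<s} \<rightarrow>\<^sub>E P. \<forall>i\<in>K. h i \<in> G (h ` J)} \<subseteq> (\<Union>u \<in> J \<rightarrow>\<^sub>E P. X u)"
  proof
    fix h assume h: "h \<in> {h \<in> {..<s} \<rightarrow>\<^sub>E P. \<forall>i\<in>K. h i \<in> G (h ` J)}"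
    have "restrict h J \<in> J \<rightarrow>\<^sub>E P" using h JK(1) by auto
    moreover have "restrict h J ` J = h ` J" by auto
    then have "h \<in> X (restrict h J)" using h by (auto simp: X_def PiE_iff)
    ultimately show "h \<in> (\<Union>u \<in> J \<rightarrow>\<^sub>E P. X u)" by blast
  qed
  then have "card {h \<in> {..<s} \<rightarrow>\<^sub>E P. \<forall>i\<in>K. h i \<in> G (h ` J)} \<le> card (\<Union>u \<in> J \<rightarrow>\<^sub>E P. X u)"
    using finX fin finJK by (intro card_mono finite_UN_I finite_PiE) auto
  also have "\<dots> \<le> (\<Sum>u \<in> J \<rightarrow>\<^sub>E P. card (X u))"
    using fin finJK by (intro card_UN_le finite_PiE)
  finally have 1: "card {h \<in> {..<s} \<rightarrow>\<^sub>E P. \<forall>i\<in>K. h i \<in> G (h ` J)} \<le> (\<Sum>u \<in> J \<rightarrow>\<^sub>E P. card (X u))" .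
  have 2: "real (card (X u)) \<le> c ^ card K * real (card P) ^ (s - card J - card K)" for u
  proof -
    have K: "K \<subseteq> {..<s} - J" using JK by auto
    have split: "prod w {..<s} = prod w J * (prod w K * prod w ({..<s} - J - K))" for w :: "nat \<Rightarrow> nat"
      using prod.subset_diff[OF JK(1), of w] prod.subset_diff[OF K, of w] by (simp add: ac_simps)
    have "card (X u) = (\<Prod>i\<in>{..<s}. card (if i \<in> J then {u i} else if i \<in> K then G (u ` J) else P))"
      unfolding X_def by (simp add: card_PiE)
    also have "\<dots> = (\<Prod>i\<in>J. card (if i \<in> J then {u i} else if i \<in> K then G (u ` J) else P)) *
        ((\<Prod>i\<in>K. card (if i \<in> J then {u i} else if i \<in> K then G (u ` J) else P)) *
         (\<Prod>i\<in>{..<s} - J - K. card (if i \<in> J then {u i} else if i \<in> K then G (u ` J) else P)))"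
      by (rule split)
    also have "(\<Prod>i\<in>J. card (if i \<in> J then {u i} else if i \<in> K then G (u ` J) else P)) = 1"
      by simp
    also have "(\<Prod>i\<in>K. card (if i \<in> J then {u i} else if i \<in> K then G (u ` J) else P)) =
        (\<Prod>i\<in>K. card (G (u ` J)))"
      using JK(3) by (intro prod.cong) auto
    also have "(\<Prod>i\<in>{..<s} - J - K. card (if i \<in> J then {u i} else if i \<in> K then G (u ` J) else P)) =
        (\<Prod>i\<in>{..<s} - J - K. card P)"
      by (intro prod.cong) auto
    finally have "card (X u) = card (G (u ` J)) ^ card K * card P ^ (s - card J - card K)"
      using card_Diff_subset[OF finJK(2) K] card_Diff_subset[OF finJK(1) JK(1)] by simp
    then have "real (card (X u)) = real (card (G (u ` J))) ^ card K * real (card P) ^ (s - card J - card K)"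
      by simp
    also have "\<dots> \<le> c ^ card K * real (card P) ^ (s - card J - card K)"
      using G(2) by (intro mult_right_mono power_mono) auto
    finally show ?thesis .
  qed
  have "card J + card K \<le> s"
    using card_mono[of "{..<s}" "J \<union> K"] JK finJK by (simp add: card_Un_disjoint)
  then have s: "s - card K = card J + (s - card J - card K)" by simp
  have "real (card {h \<in> {..<s} \<rightarrow>\<^sub>E P. \<forall>i\<in>K. h i \<in> G (h ` J)}) \<le> (\<Sum>u \<in> J \<rightarrow>\<^sub>E P. real (card (X u)))"
    using 1 by (simp flip: of_nat_sum)
  also have "\<dots> \<le> real (card (J \<rightarrow>\<^sub>E P)) * (c ^ card K * real (card P) ^ (s - card J - card K))"
    by (rule sum_bounded_above) (rule 2)
  also have "\<dots> = c ^ card K * real (card P) ^ (s - card K)"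
    using finJK(1) by (subst s) (simp add: card_PiE power_add)
  finally show ?thesis .
qed

text \<open>Some index set \<open>J\<close> yields the fingerprint \<open>F\<close> of a large good
  set \<open>I\<close>, and a disjoint set \<open>K\<close> of at least
  \<open>s / 3 - s / 12 = s / 4\<close> indices yields the rest, which lies in \<open>G F\<close>.
  Such a pair has probability at most \<open>1 / 8 ^ s\<close>, since \<open>8 ^ 4 = 4096\<close>,
  and there are at most \<open>4 ^ s\<close> pairs.\<close>

lemma few_samples_with_large_good_subset:
  fixes G :: "'p set \<Rightarrow> 'p set"
  assumes fin: "finite P" and t: "12 * t \<le> s" and s: "2 \<le> s"
    and G: "\<And>F. G F \<subseteq> P" "\<And>F. real (card (G F)) \<le> real (card P) / 4096"
    and Q: "\<And>I. I \<subseteq> P \<Longrightarrow> Q I \<Longrightarrow> \<exists>F\<subseteq>I. card F \<le> t \<and> I \<subseteq> G F"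
  shows "4 * real (card {h \<in> {..<s} \<rightarrow>\<^sub>E P. \<exists>I\<subseteq>h ` {..<s}. Q I \<and> s \<le> 3 * card I}) \<le> real (card P) ^ s"
proof -
  define E where "E J K = {h \<in> {..<s} \<rightarrow>\<^sub>E P. \<forall>i\<in>K. h i \<in> G (h ` J)}" for J K
  define D where "D = {(J, K). J \<subseteq> {..<s} \<and> K \<subseteq> {..<s} \<and> J \<inter> K = {} \<and> s \<le> 4 * card K}"
  let ?bad = "{h \<in> {..<s} \<rightarrow>\<^sub>E P. \<exists>I\<subseteq>h ` {..<s}. Q I \<and> s \<le> 3 * card I}"
  have D: "D \<subseteq> Pow {..<s} \<times> Pow {..<s}" by (auto simp: D_def)
  then have finD: "finite D" by (rule finite_subset) simp
  have finE: "finite (E J K)" for J K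
    using fin by (simp add: E_def finite_PiE)
  have "?bad \<subseteq> (\<Union>(J, K)\<in>D. E J K)"
  proof
    fix h assume "h \<in> ?bad"
    then obtain I where h: "h \<in> {..<s} \<rightarrow>\<^sub>E P" and I: "I \<subseteq> h ` {..<s}" "Q I" "s \<le> 3 * card I" by auto
    have "I \<subseteq> P" using I(1) h by auto
    then obtain F where F: "F \<subseteq> I" "card F \<le> t" "I \<subseteq> G F" using Q I(2) by blast
    define idx where "idx = inv_into {..<s} h"
    have idx: "idx p < s" "h (idx p) = p" if "p \<in> I" for p
      using inv_into_into[of p h "{..<s}"] f_inv_into_f[of p h "{..<s}"] that I(1) by (auto simp: idx_def)
    then have inj: "inj_on idx I" by (metis inj_onI)
    have finI: "finite I" using I(1) finite_subset by blast
    have "card (idx ` (I - F)) = card I - card F"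
      using inj F(1) finI by (simp add: card_image inj_on_diff card_Diff_subset finite_subset)
    then have "s \<le> 4 * card (idx ` (I - F))" using I(3) F(2) t by linarith
    moreover have "idx ` F \<inter> idx ` (I - F) = {}"
      using inj F(1) by (auto simp: inj_on_def)
    ultimately have "(idx ` F, idx ` (I - F)) \<in> D" using idx F(1) by (auto simp: D_def)
    moreover have "h ` idx ` F = F" using idx F(1) by force
    then have "h \<in> E (idx ` F) (idx ` (I - F))" using h F(3) idx by (auto simp: E_def)
    ultimately show "h \<in> (\<Union>(J, K)\<in>D. E J K)" by blast
  qed
  then have "card ?bad \<le> card (\<Union>(J, K)\<in>D. E J K)"
    using finD finE by (intro card_mono) auto
  also have "\<dots> \<le> (\<Sum>(J, K)\<in>D. card (E J K))"
    using card_UN_le[OF finD, of "\<lambda>(J, K). E J K"] by (simp add: case_prod_beta)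
  finally have "real (card ?bad) \<le> (\<Sum>(J, K)\<in>D. real (card (E J K)))"
    by (simp add: case_prod_beta flip: of_nat_sum)
  also have "\<dots> \<le> real (card D) * (real (card P) ^ s / 8 ^ s)"
  proof (intro sum_bounded_above)
    fix x assume "x \<in> D"
    then obtain J K where x: "x = (J, K)" and JK: "J \<subseteq> {..<s}" "K \<subseteq> {..<s}" "J \<inter> K = {}" "s \<le> 4 * card K"
      by (auto simp: D_def)
    have "card K \<le> s" using card_mono[OF _ JK(2)] by simp
    have "real (card (E J K)) \<le> (real (card P) / 4096) ^ card K * real (card P) ^ (s - card K)"
      unfolding E_def by (intro card_adaptive_event_le fin JK G)
    also have "\<dots> = real (card P) ^ (card K + (s - card K)) / 4096 ^ card K"
      by (simp add: power_add power_divide)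
    also have "\<dots> = real (card P) ^ s / 4096 ^ card K" using \<open>card K \<le> s\<close> by simp
    also have "\<dots> \<le> real (card P) ^ s / 8 ^ s"
    proof (intro divide_left_mono)
      have "(8::real) ^ s \<le> 8 ^ (4 * card K)" using JK(4) by (intro power_increasing) auto
      also have "\<dots> = 4096 ^ card K" by (simp add: power_mult)
      finally show "(8::real) ^ s \<le> 4096 ^ card K" .
    qed auto
    finally show "(case x of (J, K) \<Rightarrow> real (card (E J K))) \<le> real (card P) ^ s / 8 ^ s" by (simp add: x)
  qed
  also have "\<dots> \<le> 4 ^ s * (real (card P) ^ s / 8 ^ s)"
  proof (intro mult_right_mono)
    have "card D \<le> card (Pow {..<s} \<times> Pow {..<s})" using D by (intro card_mono) auto
    also have "\<dots> = 4 ^ s" by (simp add: card_cartesian_product card_Pow flip: power_mult_distrib)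
    finally show "real (card D) \<le> 4 ^ s" by (metis of_nat_le_iff of_nat_numeral of_nat_power)
  qed auto
  also have "\<dots> = real (card P) ^ s / 2 ^ s"
    using power_mult_distrib[of 4 "2::real" s] by simp
  also have "\<dots> \<le> real (card P) ^ s / 2 ^ 2"
    using s by (intro divide_left_mono power_increasing) auto
  finally show ?thesis by simp
qed

text \<open>Deleting all crowded indices leaves distinct points, at most \<open>k\<close> of them on
  each line of \<L>.\<close>

definition crowded :: "nat \<Rightarrow> nat \<Rightarrow> 'p set set \<Rightarrow> (nat \<Rightarrow> 'p) \<Rightarrow> nat \<Rightarrow> bool" where
  "crowded s k \<L> h i \<longleftrightarrow> (\<exists>j<s. j \<noteq> i \<and> h i = h j) \<or>
     (\<exists>Z\<subseteq>{..<s}. i \<notin> Z \<and> card Z = k \<and> (\<exists>l\<in>\<L>. \<forall>j\<in>insert i Z. h j \<in> l))"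

text \<open>For a fixed index, a repetition and \<open>k\<close> companions on a common line each
  have probability at most \<open>1 / 40\<close>, by union bounds over the other indices and over at
  most \<open>s ^ k\<close> index sets with all lines. So at most \<open>s / 20\<close> indices are
  crowded on average.\<close>

lemma sum_crowded_le:
  assumes fin: "finite P" "finite \<L>" and l: "\<And>l. l \<in> \<L> \<Longrightarrow> l \<subseteq> P \<and> card l \<le> M"
    and s: "40 * s \<le> card P" "40 * s ^ k * card \<L> * M ^ Suc k \<le> card P ^ Suc k"
  shows "20 * (\<Sum>h\<in>{..<s} \<rightarrow>\<^sub>E P. real (card {i\<in>{..<s}. crowded s k \<L> h i})) \<le> real s * real (card P) ^ s"
proof -
  let ?N = "real (card P)"
  let ?H = "{..<s} \<rightarrow>\<^sub>E P"
  have finH: "finite ?H" using fin by (intro finite_PiE) auto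
  have main: "20 * real (card {h\<in>?H. crowded s k \<L> h i}) \<le> ?N ^ s" if i: "i < s" for i
  proof -
    define ZZ where "ZZ = {Z. Z \<subseteq> {..<s} \<and> card Z = k}"
    define Z' where "Z' = {Z \<in> ZZ. i \<notin> Z}"
    define X where "X j = {h\<in>?H. h i = h j}" for j
    define Y where "Y Z l = {h\<in>?H. \<forall>j\<in>insert i Z. h j \<in> l}" for Z l
    have finZ: "finite ZZ" "finite Z'" by (simp_all add: ZZ_def Z'_def)
    have X: "real (card (X j)) \<le> ?N ^ (s - 1)" if "j < s" "j \<noteq> i" for j
    proof -
      \<comment> \<open>A repetition means that \<open>h i\<close> falls into the one-point set
        given by \<open>h j\<close>. The test on the cardinality makes the bound 1 hold for
        arbitrary \<open>F\<close>.\<close>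
      have "real (card {h \<in> ?H. \<forall>i\<in>{i}. h i \<in> (if card (h ` {j}) = 1 then h ` {j} \<inter> P else {})})
          \<le> 1 ^ card {i} * ?N ^ (s - card {i})"
      proof (rule card_adaptive_event_le[OF fin(1)])
        show "real (card (if card F = 1 then F \<inter> P else {})) \<le> 1" for F
          using card_mono[of F "F \<inter> P"] card_ge_0_finite[of F] by auto
      qed (use that i in auto)
      moreover have "X j = {h \<in> ?H. \<forall>i\<in>{i}. h i \<in> (if card (h ` {j}) = 1 then h ` {j} \<inter> P else {})}"
        unfolding X_def by (intro Collect_cong conj_cong refl) (simp, metis PiE_mem i lessThan_iff)
      ultimately show ?thesis by simp
    qed
    have Y: "real (card (Y Z l)) \<le> real M ^ Suc k * ?N ^ (s - Suc k)" if "Z \<in> Z'" "l \<in> \<L>" for Z l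
    proof -
      have Z: "Z \<subseteq> {..<s}" "i \<notin> Z" "card Z = k" using that(1) by (auto simp: Z'_def ZZ_def)
      have "card (insert i Z) = Suc k" using Z finite_subset[OF Z(1)] by simp
      moreover have "real (card (Y Z l)) \<le> real M ^ card (insert i Z) * ?N ^ (s - card (insert i Z))"
        unfolding Y_def using Z(1) i assms(3)[OF that(2)] by (intro card_adaptive_event_le[where J = "{}"] fin) auto
      ultimately show ?thesis by simp
    qed
    have "{h\<in>?H. crowded s k \<L> h i} \<subseteq> (\<Union>j\<in>{..<s} - {i}. X j) \<union> (\<Union>(Z, l)\<in>Z' \<times> \<L>. Y Z l)"
      by (auto simp: crowded_def X_def Y_def Z'_def ZZ_def)
    then have "card {h\<in>?H. crowded s k \<L> h i} \<le>
        card ((\<Union>j\<in>{..<s} - {i}. X j) \<union> (\<Union>(Z, l)\<in>Z' \<times> \<L>. Y Z l))"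
      using finH finZ fin(2) by (intro card_mono) (auto simp: X_def Y_def)
    also have "\<dots> \<le> card (\<Union>j\<in>{..<s} - {i}. X j) + card (\<Union>(Z, l)\<in>Z' \<times> \<L>. Y Z l)"
      by (rule card_Un_le)
    also have "\<dots> \<le> (\<Sum>j\<in>{..<s} - {i}. card (X j)) + (\<Sum>x\<in>Z' \<times> \<L>. card (case x of (Z, l) \<Rightarrow> Y Z l))"
      using finZ fin(2) by (intro add_mono card_UN_le) auto
    finally have "real (card {h\<in>?H. crowded s k \<L> h i}) \<le>
        (\<Sum>j\<in>{..<s} - {i}. real (card (X j))) + (\<Sum>x\<in>Z' \<times> \<L>. real (card (case x of (Z, l) \<Rightarrow> Y Z l)))"
      by (simp flip: of_nat_sum of_nat_add)
    moreover have "40 * (\<Sum>j\<in>{..<s} - {i}. real (card (X j))) \<le> ?N ^ s"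
    proof -
      have "(\<Sum>j\<in>{..<s} - {i}. real (card (X j))) \<le> real (card ({..<s} - {i})) * ?N ^ (s - 1)"
        using X by (intro sum_bounded_above) auto
      also have "\<dots> \<le> real s * ?N ^ (s - 1)"
        using card_mono[of "{..<s}" "{..<s} - {i}"] by (intro mult_right_mono) auto
      finally have "40 * (\<Sum>j\<in>{..<s} - {i}. real (card (X j))) \<le> (40 * real s) * ?N ^ (s - 1)" by simp
      also have "\<dots> \<le> ?N * ?N ^ (s - 1)" using s(1) by (intro mult_right_mono) auto
      also have "\<dots> = ?N ^ s" using i by (simp flip: power_Suc)
      finally show ?thesis .
    qed
    moreover have "40 * (\<Sum>x\<in>Z' \<times> \<L>. real (card (case x of (Z, l) \<Rightarrow> Y Z l))) \<le> ?N ^ s"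
    \<comment> \<open>A nonempty \<open>Z'\<close> ensures \<open>Suc k \<le> s\<close>, so that
      \<open>s - Suc k\<close> does not truncate.\<close>
    proof (cases "Z' = {}")
      case True
      then show ?thesis by simp
    next
      case False
      then obtain Z where Z: "Z \<subseteq> {..<s}" "i \<notin> Z" "card Z = k" by (auto simp: Z'_def ZZ_def)
      have "card (insert i Z) \<le> card {..<s}" using Z i by (intro card_mono) auto
      then have ks: "Suc k \<le> s" using Z finite_subset[OF Z(1)] by simp
      have "card Z' \<le> card ZZ" using finZ by (intro card_mono) (auto simp: Z'_def)
      also have "\<dots> \<le> s ^ k" using ks n_subsets[of "{..<s}" k] binomial_le_pow[of k s] by (simp add: ZZ_def)
      finally have cZ: "card Z' \<le> s ^ k" .
      have "(\<Sum>x\<in>Z' \<times> \<L>. real (card (case x of (Z, l) \<Rightarrow> Y Z l))) \<le>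
          real (card (Z' \<times> \<L>)) * (real M ^ Suc k * ?N ^ (s - Suc k))"
        using Y by (intro sum_bounded_above) auto
      also have "\<dots> \<le> real (s ^ k * card \<L>) * (real M ^ Suc k * ?N ^ (s - Suc k))"
        using cZ by (intro mult_right_mono) (auto simp: card_cartesian_product simp del: of_nat_mult)
      finally have "40 * (\<Sum>x\<in>Z' \<times> \<L>. real (card (case x of (Z, l) \<Rightarrow> Y Z l))) \<le>
          real (40 * s ^ k * card \<L> * M ^ Suc k) * ?N ^ (s - Suc k)" by (simp add: algebra_simps)
      also have "\<dots> \<le> real (card P ^ Suc k) * ?N ^ (s - Suc k)"
        using s(2) by (intro mult_right_mono) (simp_all only: of_nat_le_iff, simp)
      also have "\<dots> = ?N ^ (Suc k + (s - Suc k))" by (simp only: power_add of_nat_power)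
      finally show ?thesis using ks by simp
    qed
    ultimately show ?thesis by linarith
  qed
  have "(\<Sum>h\<in>?H. card {i\<in>{..<s}. crowded s k \<L> h i}) = (\<Sum>h\<in>?H. \<Sum>i<s. if crowded s k \<L> h i then 1 else 0)"
    by (simp add: sum.If_cases Int_def)
  also have "\<dots> = (\<Sum>i<s. \<Sum>h\<in>?H. if crowded s k \<L> h i then 1 else 0)" by (rule sum.swap)
  also have "\<dots> = (\<Sum>i<s. card {h\<in>?H. crowded s k \<L> h i})"
    using finH by (simp add: sum.If_cases Int_def)
  finally have "(\<Sum>h\<in>?H. real (card {i\<in>{..<s}. crowded s k \<L> h i})) =
      (\<Sum>i<s. real (card {h\<in>?H. crowded s k \<L> h i}))"
    by (simp flip: of_nat_sum)
  then have "20 * (\<Sum>h\<in>?H. real (card {i\<in>{..<s}. crowded s k \<L> h i})) =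
      (\<Sum>i<s. 20 * real (card {h\<in>?H. crowded s k \<L> h i}))"
    by (simp only: sum_distrib_left)
  also have "\<dots> \<le> (\<Sum>i<s. ?N ^ s)" using main by (intro sum_mono) auto
  finally show ?thesis by simp
qed

text \<open>At most a quarter of the samples have a large good subset. As the mean number of crowded
  indices is at most \<open>s / 20\<close>, at most half of the samples have more than
  \<open>s / 10\<close>. Some sample avoids both, and deleting its crowded indices gives
  \<open>S\<close>.\<close>

lemma sparse_sample_exists:
  fixes G :: "'p set \<Rightarrow> 'p set"
  assumes fin: "finite P" "finite \<L>" and l: "\<And>l. l \<in> \<L> \<Longrightarrow> l \<subseteq> P \<and> card l \<le> M"
    and t: "12 * t \<le> s" and s: "2 \<le> s"
    and cond: "40 * s \<le> card P" "40 * s ^ k * card \<L> * M ^ Suc k \<le> card P ^ Suc k"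
    and G: "\<And>F. G F \<subseteq> P" "\<And>F. real (card (G F)) \<le> real (card P) / 4096"
    and Q: "\<And>I. I \<subseteq> P \<Longrightarrow> Q I \<Longrightarrow> \<exists>F\<subseteq>I. card F \<le> t \<and> I \<subseteq> G F"
  shows "\<exists>S\<subseteq>P. 9 * s \<le> 10 * card S \<and> card S \<le> s \<and> (\<forall>l\<in>\<L>. card (S \<inter> l) \<le> k) \<and>
    (\<forall>I\<subseteq>S. Q I \<longrightarrow> 3 * card I < s)"
proof -
  let ?N = "real (card P)"
  let ?H = "{..<s} \<rightarrow>\<^sub>E P"
  define bad where "bad = {h \<in> ?H. \<exists>I\<subseteq>h ` {..<s}. Q I \<and> s \<le> 3 * card I}"
  define cr where "cr h = {i\<in>{..<s}. crowded s k \<L> h i}" for h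
  have finH: "finite ?H" using fin by (intro finite_PiE) auto
  have N: "0 < ?N" using cond(1) s by simp
  have b1: "4 * real (card bad) \<le> ?N ^ s"
    unfolding bad_def by (rule few_samples_with_large_good_subset[OF fin(1) t s G Q])
  have b2: "20 * (\<Sum>h\<in>?H. real (card (cr h))) \<le> real s * ?N ^ s"
    unfolding cr_def by (rule sum_crowded_le[OF fin l cond])
  have "\<exists>h\<in>?H - bad. 10 * card (cr h) \<le> s"
  proof (rule ccontr)
    assume "\<not> ?thesis"
    then have "real s / 10 \<le> real (card (cr h))" if "h \<in> ?H - bad" for h
      using that by force
    then have "real (card (?H - bad)) * (real s / 10) \<le> (\<Sum>h\<in>?H - bad. real (card (cr h)))"
      by (intro sum_bounded_below) auto
    also have "\<dots> \<le> (\<Sum>h\<in>?H. real (card (cr h)))" using finH by (intro sum_mono2) auto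
    finally have "2 * real (card (?H - bad)) * real s \<le> real s * ?N ^ s" using b2 by simp
    then have "2 * real (card (?H - bad)) \<le> ?N ^ s" using s by (simp add: mult.commute)
    moreover have "card ?H = card P ^ s" by (simp add: card_PiE)
    moreover have "bad \<subseteq> ?H" by (auto simp: bad_def)
    then have "card ?H = card (?H - bad) + card bad"
      using finH by (metis card_Diff_subset card_mono finite_subset le_add_diff_inverse2)
    ultimately have "?N ^ s = real (card (?H - bad)) + real (card bad)"
      by (metis of_nat_add of_nat_power)
    moreover have "0 < ?N ^ s" using N by simp
    ultimately show False using b1 \<open>2 * real (card (?H - bad)) \<le> ?N ^ s\<close> by linarith
  qed
  then obtain h where h: "h \<in> ?H" "h \<notin> bad" "10 * card (cr h) \<le> s" by auto
  define K where "K = {..<s} - cr h"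
  define S where "S = h ` K"
  have inj: "inj_on h K"
    by (rule inj_onI) (auto simp: K_def cr_def crowded_def)
  have "cr h \<subseteq> {..<s}" by (auto simp: cr_def)
  then have "card K = s - card (cr h)" unfolding K_def by (subst card_Diff_subset) (auto intro: finite_subset)
  then have cS: "card S = s - card (cr h)" using inj by (simp add: S_def card_image)
  have "card (S \<inter> l) \<le> k" if "l \<in> \<L>" for l
  proof (rule ccontr)
    assume "\<not> ?thesis"
    moreover have "S \<inter> l = h ` {i \<in> K. h i \<in> l}" by (auto simp: S_def)
    moreover have "card (h ` {i \<in> K. h i \<in> l}) = card {i \<in> K. h i \<in> l}"
      using inj by (intro card_image) (auto simp: inj_on_def)
    ultimately have "Suc k \<le> card {i \<in> K. h i \<in> l}" by simp
    then obtain Y where Y: "Y \<subseteq> {i \<in> K. h i \<in> l}" "card Y = Suc k" by (meson obtain_subset_with_card_n)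
    then obtain i Z where iZ: "Y = insert i Z" "i \<notin> Z" "card Z = k" by (metis card_Suc_eq)
    have "crowded s k \<L> h i"
      unfolding crowded_def using iZ Y(1) that by (intro disjI2 exI[of _ Z]) (auto simp: K_def)
    moreover have "i \<in> K" using iZ Y(1) by auto
    ultimately show False by (auto simp: K_def cr_def)
  qed
  moreover have "3 * card I < s" if "I \<subseteq> S" "Q I" for I
  proof -
    have "I \<subseteq> h ` {..<s}" using that(1) by (auto simp: S_def K_def)
    then show ?thesis using h(1,2) that(2) by (auto simp: bad_def not_le)
  qed
  moreover have "S \<subseteq> P" using h(1) by (auto simp: S_def K_def)
  ultimately show ?thesis using cS h(3) by (intro exI[of _ S]) auto
qed

section \<open>Large nets\<close>

text \<open>Containers of density \<open>1 / 4096\<close> meet a random sample of \<open>s\<close>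
  points. The bound on \<open>Q\<close> keeps the fingerprints below \<open>s / 12\<close>; the
  bound on \<open>s\<close> makes the margin of \<open>M * q\<close> heights small compared with
  \<open>m\<close>.\<close>

lemma sparse_grid_subset_exists:
  fixes k Q s :: nat
  assumes k: "1 \<le> k" and Q: "2 ^ (16384 * k + 38) * (4 * k) ^ (k + 1) \<le> Q" and s: "Q ^ (k * k) \<le> s"
  shows "\<exists>q m S. finite S \<and> 9 * s \<le> 10 * card S \<and> card S \<le> s \<and>
    (\<forall>l\<in>line_family q m. card {j. (j, height j l) \<in> S} \<le> k) \<and>
    (\<forall>I\<subseteq>S. line_free k (line_family q m) I \<longrightarrow> 3 * card I < s)"
proof -
  \<comment> \<open>With these choices, \<open>m ^ k = 100 ^ k * q * s ^ k\<close> makes lines with more than \<open>k\<close> sample points rare,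
    while the number of picked points is about \<open>n * k * mu / Q ^ k\<close>, that is, of order \<open>n * k * s / Q\<close>.\<close>
  define M where "M = 16384 * k"
  define q where "q = (Q ^ k) ^ (k - 1)"
  define m where "m = 100 * Q ^ (k - 1) * s"
  define mu where "mu = m + M * q"
  define f where "f = mu div Q ^ k + 1"
  define n where "n = M * 2 ^ 16 * 2 ^ M * (4 * k) ^ (k - 1)"
  have M1: "1 \<le> M" using k by (simp add: M_def)
  have big: "2 ^ 38 * (4 * k) * (2 ^ M * (4 * k) ^ k) \<le> Q"
    using Q by (simp add: M_def power_add algebra_simps)
  moreover have "1 \<le> 2 ^ M * (4 * k) ^ k" using k by simp
  ultimately have "2 ^ 38 * (4 * k) \<le> Q"
    by (metis mult.right_neutral mult_le_mono2 order_trans)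
  then have Qk: "1099511627776 * k \<le> Q" by simp
  then have Q1: "1 \<le> Q" using k by linarith
  have Qpow: "Q ^ k * q = Q ^ (k * k)"
    unfolding q_def power_Suc[symmetric] using k by (simp add: power_mult)
  have QQ: "Q * Q ^ (k - 1) = Q ^ k" using k by (simp flip: power_Suc)
  have qs: "16384 * M * q \<le> m"
  proof -
    have "16384 * M \<le> Q" using Qk by (simp add: M_def)
    also have "\<dots> \<le> Q ^ k" using Q1 k by (metis power_increasing power_one_right)
    finally have "16384 * M * q \<le> Q ^ k * q" by (rule mult_le_mono1)
    also have "\<dots> \<le> 1 * s" using s Qpow by simp
    also have "\<dots> \<le> m" unfolding m_def using Q1 by (intro mult_le_mono1) simp
    finally show ?thesis .
  qed
  have "Q \<le> Q ^ (k * k)" using Q1 k by (metis mult_le_mono mult.right_neutral power_increasing power_one_right)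
  then have Qs: "Q \<le> s" using s by linarith
  have s2: "2 \<le> s" using Qs Qk k by linarith
  interpret grid k M "Q ^ k" f m mu "1 / 4096"
  proof
    show "mu \<le> f * Q ^ k"
      unfolding f_def using Q1 dividend_less_div_times[of "Q ^ k" mu] by simp
    have "real (16384 * M * q) \<le> real mu" using qs by (simp only: of_nat_le_iff mu_def)
    then show "4 * real M * real ((Q ^ k) ^ (k - 1)) \<le> 1 / 4096 * real mu" by (simp add: q_def)
  qed (use k Q1 in \<open>simp_all add: mu_def q_def M_def\<close>)
  \<comment> \<open>The factor \<open>2 ^ 16\<close> in \<open>n\<close> is
    \<open>4096 * 4 * 4\<close>, the constants in \<open>decrement\<close> at density
    \<open>1 / 4096\<close>.\<close>
  have decrement: "real n * decrement = real M"
    using k by (simp add: decrement_def n_def)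
  obtain G where G: "\<And>F. G F \<subseteq> points" "\<And>F. real (card (G F)) \<le> 1 / 4096 * real M * real mu"
    "\<And>I. I \<subseteq> points \<Longrightarrow> line_free k lines I \<Longrightarrow> \<exists>F\<subseteq>I. card F \<le> n * ((k - 1) * f) \<and> I \<subseteq> G F"
    using containers[of n] decrement by auto
  define ln where "ln l = (\<lambda>j. (j, height j l)) ` {..<M}" for l
  have mm: "mu \<le> 200 * Q ^ (k - 1) * s" using qs by (simp add: mu_def m_def)
  have t: "12 * (n * ((k - 1) * f)) \<le> s"
  proof -
    have "(mu div Q ^ k) * Q * Q ^ (k - 1) \<le> 200 * s * Q ^ (k - 1)"
      using mm QQ by (metis (no_types, lifting) div_times_less_eq_dividend mult.assoc mult.commute order_trans)
    then have "(mu div Q ^ k) * Q \<le> 200 * s" using Q1 by simp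
    then have fQ: "f * Q \<le> 201 * s" using Qs by (simp add: f_def)
    have "12 * 201 * k * n \<le> 2 ^ 12 * k * n" by simp
    also have "\<dots> = 2 ^ 40 * (4 * k) * (2 ^ M * (4 * k) ^ (k - 1)) * k"
      by (simp add: n_def M_def)
    also have "\<dots> = 2 ^ 38 * (4 * k) * (2 ^ M * ((4 * k) * (4 * k) ^ (k - 1)))" by simp
    also have "(4 * k) * (4 * k) ^ (k - 1) = (4 * k) ^ k"
      unfolding power_Suc[symmetric] using k by simp
    finally have nQ: "12 * 201 * k * n \<le> Q" using big by linarith
    have "12 * (n * ((k - 1) * f)) * Q = 12 * n * (k - 1) * (f * Q)" by simp
    also have "\<dots> \<le> 12 * n * k * (201 * s)" by (rule mult_le_mono[OF _ fQ]) simp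
    also have "\<dots> = 12 * 201 * k * n * s" by simp
    also have "\<dots> \<le> s * Q" using mult_le_mono1[OF nQ, of s] by (simp add: mult.commute)
    finally show ?thesis using Q1 by simp
  qed
  have c1: "40 * s \<le> card points"
  proof -
    have "40 \<le> 100 * Q ^ (k - 1)" using one_le_power[OF Q1, of "k - 1"] by linarith
    then have "40 * s \<le> 1 * m" unfolding m_def nat_mult_1 by (rule mult_le_mono1)
    also have "\<dots> \<le> M * mu" using M1 by (intro mult_le_mono) (simp_all add: mu_def)
    finally show ?thesis by (simp add: card_cartesian_product)
  qed
  have c2: "40 * s ^ k * card (ln ` lines) * M ^ Suc k \<le> card points ^ Suc k"
  proof -
    have "40 * s ^ k * q \<le> 100 ^ k * s ^ k * q"
      using power_increasing[of 1 k "100::nat"] k by (intro mult_le_mono1) simp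
    also have "\<dots> = m ^ k"
      by (simp add: m_def q_def power_mult_distrib flip: power_mult) (simp add: mult.commute)
    also have "\<dots> \<le> mu ^ k" by (intro power_mono) (simp_all add: mu_def)
    finally have *: "40 * s ^ k * q \<le> mu ^ k" .
    have "card (ln ` lines) \<le> q * m"
      using card_image_le[of lines ln] by (simp add: card_cartesian_product q_def)
    also have "\<dots> \<le> q * mu" by (simp add: mu_def)
    finally have "40 * s ^ k * card (ln ` lines) \<le> 40 * s ^ k * (q * mu)" by (rule mult_le_mono2)
    also have "\<dots> = 40 * s ^ k * q * mu" by simp
    also have "\<dots> \<le> mu ^ k * mu" by (intro mult_le_mono1 *)
    finally have "40 * s ^ k * card (ln ` lines) * M ^ Suc k \<le> mu ^ k * mu * M ^ Suc k"
      by (rule mult_le_mono1)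
    also have "\<dots> = card points ^ Suc k" by (simp add: card_cartesian_product power_mult_distrib)
    finally show ?thesis .
  qed
  have "\<exists>S\<subseteq>points. 9 * s \<le> 10 * card S \<and> card S \<le> s \<and> (\<forall>l\<in>ln ` lines. card (S \<inter> l) \<le> k) \<and>
    (\<forall>I\<subseteq>S. line_free k lines I \<longrightarrow> 3 * card I < s)"
  proof (rule sparse_sample_exists[where G = G])
    show "l \<subseteq> points \<and> card l \<le> M" if l: "l \<in> ln ` lines" for l
    proof -
      obtain l' where l': "l' \<in> lines" "l = ln l'" using l by blast
      have "card l \<le> M" using card_image_le[of "{..<M}" "\<lambda>j. (j, height j l')"] by (simp add: l'(2) ln_def)
      moreover have "l \<subseteq> points" using height_less[OF l'(1)] by (auto simp: l'(2) ln_def mu_def q_def)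
      ultimately show ?thesis by simp
    qed
    show "real (card (G F)) \<le> real (card points) / 4096" for F
      using G(2)[of F] by (simp add: card_cartesian_product)
  qed (use t s2 c1 c2 G(1,3) in \<open>simp_all\<close>)
  then obtain S where S: "S \<subseteq> points" "9 * s \<le> 10 * card S" "card S \<le> s"
    "\<forall>l\<in>ln ` lines. card (S \<inter> l) \<le> k" "\<forall>I\<subseteq>S. line_free k lines I \<longrightarrow> 3 * card I < s"
    by (elim exE conjE) (rule that)
  have "finite S" using S(1) finite_subset by blast
  moreover have "card {j. (j, height j l) \<in> S} = card (S \<inter> ln l)" for l
  proof -
    have "S \<inter> ln l = (\<lambda>j. (j, height j l)) ` {j. (j, height j l) \<in> S}"
      using S(1) by (auto simp: ln_def)
    then show ?thesis by (simp add: card_image inj_on_def)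
  qed
  ultimately show ?thesis using S(2-5) by (intro exI[of _ "(Q ^ k) ^ (k - 1)"] exI[of _ m] exI[of _ S]) auto
qed

text \<open>The complement \<open>I\<close> of a net in the sample is line-free: a line with
  \<open>k\<close> points of \<open>I\<close> is heavy as \<open>eps * s \<le> k\<close>, so the net
  adds a further point, exceeding the limit of \<open>k\<close>. Hence \<open>card T\<close> is at
  least \<open>9 * s / 10 - s / 3 = 17 * s / 30\<close>.\<close>

lemma planar_set_with_large_nets:
  fixes k Q s :: nat
  assumes k: "1 \<le> k" and Q: "2 ^ (16384 * k + 38) * (4 * k) ^ (k + 1) \<le> Q" and s: "Q ^ (k * k) \<le> s" "1 \<le> s"
  shows "\<exists>S. finite S \<and> S \<noteq> {} \<and>
    (\<forall>eps T. 0 < eps \<and> eps * real s \<le> real k \<and> eps_net_lines eps S T \<longrightarrow> 17 * s \<le> 30 * card T)"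
proof -
  obtain q m S0 where S0: "finite S0" "9 * s \<le> 10 * card S0" "card S0 \<le> s"
    and few: "\<forall>l\<in>line_family q m. card {j. (j, height j l) \<in> S0} \<le> k"
    and small: "\<forall>I\<subseteq>S0. line_free k (line_family q m) I \<longrightarrow> 3 * card I < s"
    using sparse_grid_subset_exists[OF k Q s(1)] by (elim exE conjE) (rule that)
  define \<phi> where "\<phi> = (\<lambda>(j, y). (real j, real y))"
  have inj: "inj \<phi>" by (auto simp: inj_def \<phi>_def)
  define S where "S = \<phi> ` S0"
  have cS: "card S = card S0" unfolding S_def using inj by (intro card_image) (auto simp: inj_on_def)
  have "17 * s \<le> 30 * card T"
    if eps: "0 < eps" "eps * real s \<le> real k" and net: "eps_net_lines eps S T" for eps T
  proof -
    have TS: "T \<subseteq> S" and hit: "\<And>L. is_line L \<Longrightarrow> eps * real (card S) \<le> real (card (L \<inter> S)) \<Longrightarrow> T \<inter> L \<noteq> {}"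
      using net unfolding eps_net_lines_def by auto
    define I where "I = {p \<in> S0. \<phi> p \<notin> T}"
    have "line_free k (line_family q m) I"
      unfolding line_free_def
    proof (intro ballI, rule ccontr)
      fix l assume l: "l \<in> line_family q m" and "\<not> card {j. (j, height j l) \<in> I} < k"
      then have ge: "k \<le> card {j. (j, height j l) \<in> I}" by simp
      define L where "L = {(x, y). real (fst l) * x + (- 1) * y = - real (snd l)}"
      have "is_line L" unfolding is_line_def L_def
        by (intro exI[of _ "real (fst l)"] exI[of _ "- 1"] exI[of _ "- real (snd l)"]) simp
      have onL: "\<phi> (j, y) \<in> L \<longleftrightarrow> y = height j l" for j y
      proof -
        have "\<phi> (j, y) \<in> L \<longleftrightarrow> real (fst l) * real j + real (snd l) = real y"
          by (auto simp: L_def \<phi>_def)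
        also have "\<dots> \<longleftrightarrow> real (height j l) = real y" by (simp add: height_def)
        finally show ?thesis by auto
      qed
      have fin: "finite {j. (j, height j l) \<in> S0}"
        by (rule finite_subset[of _ "fst ` S0"]) (use S0(1) in force)+
      have "(\<lambda>j. \<phi> (j, height j l)) ` {j. (j, height j l) \<in> I} \<subseteq> L \<inter> S"
        using onL by (auto simp: S_def I_def)
      then have "card ((\<lambda>j. \<phi> (j, height j l)) ` {j. (j, height j l) \<in> I}) \<le> card (L \<inter> S)"
        using S0(1) by (intro card_mono) (auto simp: S_def)
      moreover have "card ((\<lambda>j. \<phi> (j, height j l)) ` {j. (j, height j l) \<in> I}) = card {j. (j, height j l) \<in> I}"
        by (intro card_image) (auto simp: inj_on_def \<phi>_def)
      ultimately have "real k \<le> real (card (L \<inter> S))" using ge by simp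
      moreover have "eps * real (card S) \<le> eps * real s" using eps(1) S0(3) cS by (intro mult_left_mono) auto
      ultimately have "T \<inter> L \<noteq> {}" using eps(2) by (intro hit[OF \<open>is_line L\<close>]) linarith
      then obtain p where "p \<in> T" "p \<in> L" by blast
      moreover from \<open>p \<in> T\<close> obtain x where "x \<in> S0" "p = \<phi> x" using TS unfolding S_def by blast
      ultimately obtain j y where jy: "(j, y) \<in> S0" "\<phi> (j, y) \<in> T" "\<phi> (j, y) \<in> L" by (metis surj_pair)
      then have "j \<in> {j. (j, height j l) \<in> S0} - {j. (j, height j l) \<in> I}" using onL by (auto simp: I_def)
      then have "{j. (j, height j l) \<in> I} \<subset> {j. (j, height j l) \<in> S0}" by (auto simp: I_def)
      then have "card {j. (j, height j l) \<in> I} < card {j. (j, height j l) \<in> S0}"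
        by (rule psubset_card_mono[OF fin])
      then show False using bspec[OF few l] ge by linarith
    qed
    moreover have "I \<subseteq> S0" by (auto simp: I_def)
    ultimately have I: "3 * card I < s" using small by simp
    have "S \<subseteq> \<phi> ` I \<union> T" by (auto simp: S_def I_def)
    moreover have "finite T" using TS S0(1) finite_subset by (auto simp: S_def)
    moreover have "finite I" using S0(1) by (simp add: I_def)
    ultimately have "card S \<le> card (\<phi> ` I \<union> T)" by (intro card_mono) auto
    also have "\<dots> \<le> card (\<phi> ` I) + card T" by (rule card_Un_le)
    also have "\<dots> \<le> card I + card T" using \<open>finite I\<close> by (simp add: card_image_le)
    finally show ?thesis using I S0(2) cS by linarith
  qed
  moreover have "finite S" "S \<noteq> {}" using S0(1,2) s(2) by (auto simp: S_def)
  ultimately show ?thesis by blast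
qed

section \<open>Choice of the parameters in terms of \<open>eps\<close>\<close>

lemma fingerprint_base_le:
  assumes "2 ^ c \<le> k" "16427 \<le> c"
  shows "2 ^ (16384 * k + 38) * (4 * k) ^ (k + 1) \<le> k ^ (2 * k)"
proof -
  have "1 \<le> k" using assms(1) by (metis one_le_numeral one_le_power order_trans)
  \<comment> \<open>All factors except \<open>k ^ k\<close> are bounded by powers of two. The
    exponents add up to \<open>16384 + 38 + 4 + 1 = 16427\<close> times \<open>k\<close>, and
    \<open>2 ^ c \<le> k\<close> turns this power into a second \<open>k ^ k\<close>.\<close>
  then have "2 ^ (16384 * k + 38) * 4 ^ (k + 1) * (k * k ^ k) \<le> 2 ^ (16384 * k + 38 * k) * 4 ^ (k + k) * (2 ^ k * k ^ k)"
    using less_imp_le[OF less_exp[of k]] by (intro mult_le_mono power_increasing) simp_all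
  also have "\<dots> = 2 ^ (16384 * k + 38 * k) * 2 ^ (2 * (k + k)) * (2 ^ k * k ^ k)"
    by (simp only: power_mult) simp
  also have "\<dots> = 2 ^ (16384 * k + 38 * k + 2 * (k + k) + k) * k ^ k"
    by (simp only: power_add mult.assoc)
  also have "\<dots> \<le> 2 ^ (c * k) * k ^ k"
    using mult_le_mono1[OF assms(2), of k] by (intro mult_le_mono1 power_increasing) simp_all
  also have "\<dots> \<le> k ^ k * k ^ k"
    using power_mono[OF assms(1), of k] by (intro mult_le_mono1) (simp add: power_mult)
  also have "\<dots> = k ^ (2 * k)" by (simp add: mult_2 power_add)
  finally show ?thesis by (simp add: power_mult_distrib ac_simps)
qed

text \<open>Take \<open>Y\<close> rounded up as \<open>k\<close>, \<open>k / eps\<close> rounded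
  down as \<open>s\<close>, and \<open>Q = k ^ (2 * k)\<close>. Then
  \<open>Q ^ (k * k) \<le> s\<close> follows from \<open>2 * k ^ 3 * log 2 k \<le> X\<close>, which
  is what the cube root and the logarithm in \<open>Y\<close> provide.\<close>

lemma large_nets_at_scale:
  fixes eps X Y :: real and c :: nat
  defines "X \<equiv> log 2 (1 / eps)" and "Y \<equiv> X powr (1/3) / log 2 X"
  assumes eps: "0 < eps" "eps < 1"
    and X: "16 \<le> X" "2 * Y \<le> X" and Y: "2 ^ c \<le> Y" "9 \<le> Y" and c: "16427 \<le> c"
  shows "\<exists>S. finite S \<and> S \<noteq> {} \<and> (\<forall>T. eps_net_lines eps S T \<longrightarrow> 1 / (2 * eps) * Y \<le> real (card T))"
proof -
  define k where "k = nat \<lceil>Y\<rceil>"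
  define s where "s = nat \<lfloor>real k / eps\<rfloor>"
  have k: "Y \<le> real k" "real k \<le> 2 * Y" "9 \<le> real k" using Y(2) unfolding k_def by linarith+
  have s: "real s \<le> real k / eps" "real k / eps - 1 \<le> real s"
    using eps k unfolding s_def by (simp_all add: le_nat_floor)
  have "(2::real) ^ c \<le> real k" using Y(1) k(1) by (rule order_trans)
  then have ck: "2 ^ c \<le> k" by (metis of_nat_le_iff of_nat_numeral of_nat_power)
  have "log 2 16 \<le> log 2 X" using X(1) by simp
  moreover have "log 2 16 = (4::real)" using log_of_power_eq[of 16 2 4] by simp
  ultimately have lX: "4 \<le> log 2 X" by simp
  have "real (k ^ (2 * k)) ^ (k * k) = 2 powr (2 * real k ^ 3 * log 2 (real k))"
  proof -
    have "real (k ^ (2 * k)) ^ (k * k) = real k ^ (2 * k ^ 3)"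
      by (simp add: power3_eq_cube mult.assoc flip: power_mult)
    also have "\<dots> = real k powr real (2 * k ^ 3)"
      using k(3) by (intro powr_realpow[symmetric]) simp
    also have "\<dots> = (2 powr log 2 (real k)) powr real (2 * k ^ 3)"
      using k(3) by simp
    finally show ?thesis by (simp add: powr_powr mult.commute mult.assoc)
  qed
  also have "\<dots> \<le> 2 powr X"
  proof (rule powr_mono)
    \<comment> \<open>Rounding costs at most a factor 2, and \<open>2 * Y \<le> X\<close> bounds
      \<open>log 2 k\<close> by \<open>log 2 X\<close>.\<close>
    have "real k ^ 3 * log 2 (real k) \<le> (2 * Y) ^ 3 * log 2 X"
      using k X by (intro mult_mono power_mono) auto
    also have "(2 * Y) ^ 3 = 8 * X / (log 2 X) ^ 3"
    proof -
      have "(X powr (1/3)) ^ 3 = X" using X(1) by (simp flip: powr_numeral add: powr_powr)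
      then show ?thesis by (simp add: Y_def power_mult_distrib power_divide)
    qed
    also have "8 * X / (log 2 X) ^ 3 * log 2 X = 8 * X / (log 2 X)\<^sup>2"
      using lX by (simp add: power3_eq_cube power2_eq_square)
    also have "\<dots> \<le> 8 * X / 16"
      using X(1) power_mono[OF lX, of 2] by (intro divide_left_mono) auto
    finally show "2 * real k ^ 3 * log 2 (real k) \<le> X" by simp
  qed simp
  also have "\<dots> = 1 / eps" unfolding X_def using eps by simp
  also have "\<dots> \<le> real s"
  proof -
    have "1 \<le> 1 / eps" using eps by simp
    moreover have "2 / eps \<le> real k / eps" using k(3) eps by (intro divide_right_mono) auto
    ultimately show ?thesis using s(2) by (simp add: field_simps)
  qed
  finally have Qs: "(k ^ (2 * k)) ^ (k * k) \<le> s" by (metis of_nat_le_iff of_nat_power)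
  have "1 \<le> (k ^ (2 * k)) ^ (k * k)" using k(3) by (intro one_le_power) simp
  then have "1 \<le> s" using Qs by (rule order_trans)
  moreover have "1 \<le> k" using k(3) by simp
  ultimately obtain S where S: "finite S" "S \<noteq> {}"
    "\<And>e T. 0 < e \<Longrightarrow> e * real s \<le> real k \<Longrightarrow> eps_net_lines e S T \<Longrightarrow> 17 * s \<le> 30 * card T"
    using planar_set_with_large_nets[OF _ fingerprint_base_le[OF ck c] Qs] by blast
  have "1 / (2 * eps) * Y \<le> real (card T)" if "eps_net_lines eps S T" for T
  proof -
    have "17 * s \<le> 30 * card T" using s(1) eps that by (intro S(3)) (auto simp: field_simps)
    then have T: "17 * real s \<le> 30 * real (card T)" by (simp flip: of_nat_mult)
    define z w where "z = Y / eps" and "w = real k / eps"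
    have "z \<le> w" unfolding z_def w_def using k(1) eps by (intro divide_right_mono) auto
    moreover have "9 * eps \<le> Y" using Y(2) eps by linarith
    then have "9 \<le> z" using eps by (simp add: z_def field_simps)
    \<comment> \<open>From \<open>w \<ge> 9\<close> one gets
      \<open>17 * (w - 1) / 30 \<ge> w / 2\<close>, which absorbs the rounding of
      \<open>s\<close>.\<close>
    ultimately have "z / 2 \<le> real (card T)" using T s(2)[folded w_def] by linarith
    then show ?thesis by (simp add: z_def)
  qed
  then show ?thesis using S(1,2) by blast
qed

theorem theorem2p2:
  shows "\<exists>e0 > 0. \<forall>eps. 0 < eps \<and> eps < e0 \<longrightarrow>
    (\<exists>S :: (real \<times> real) set. finite S \<and> S \<noteq> {} \<and>
      (\<forall>T. eps_net_lines eps S T \<longrightarrow>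
         real (card T) \<ge> (1 / (2 * eps)) * (log 2 (1 / eps)) powr (1/3) / log 2 (log 2 (1 / eps))))"
proof -
  let ?Y = "\<lambda>X::real. X powr (1/3) / log 2 X"
  obtain c :: nat where c: "16427 \<le> c" by blast
  \<comment> \<open>Besides \<open>eps < 1\<close>, all requirements on \<open>eps\<close> concern
    \<open>X = log 2 (1 / eps)\<close>, which tends to infinity as \<open>eps\<close> tends to 0
    from the right.\<close>
  have "filterlim (\<lambda>e::real. log 2 (1 / e)) at_top (at_right 0)" by real_asymp
  note ev = eventually_compose_filterlim[OF _ this]
  have "filterlim ?Y at_top at_top" by real_asymp
  then have Y: "eventually (\<lambda>X. 2 ^ c \<le> ?Y X) at_top" "eventually (\<lambda>X. 9 \<le> ?Y X) at_top"
    unfolding filterlim_at_top by blast+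
  have XY: "eventually (\<lambda>X::real. 2 * ?Y X \<le> X) at_top" by real_asymp
  have "eventually (\<lambda>e. 16 \<le> log 2 (1 / e) \<and> 2 * ?Y (log 2 (1 / e)) \<le> log 2 (1 / e) \<and>
      2 ^ c \<le> ?Y (log 2 (1 / e)) \<and> 9 \<le> ?Y (log 2 (1 / e))) (at_right 0)"
    by (intro eventually_conj ev[OF eventually_ge_at_top] ev[OF XY] ev[OF Y(1)] ev[OF Y(2)])
  then obtain e0 :: real where e0: "0 < e0" "\<And>e. 0 < e \<Longrightarrow> e < e0 \<Longrightarrow> 16 \<le> log 2 (1 / e) \<and>
      2 * ?Y (log 2 (1 / e)) \<le> log 2 (1 / e) \<and> 2 ^ c \<le> ?Y (log 2 (1 / e)) \<and> 9 \<le> ?Y (log 2 (1 / e))"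
    unfolding eventually_at_right_field by blast
  show ?thesis
  proof (intro exI[of _ "min e0 1"] conjI allI impI)
    fix eps :: real
    assume "0 < eps \<and> eps < min e0 1"
    then show "\<exists>S :: (real \<times> real) set. finite S \<and> S \<noteq> {} \<and>
      (\<forall>T. eps_net_lines eps S T \<longrightarrow>
         real (card T) \<ge> (1 / (2 * eps)) * (log 2 (1 / eps)) powr (1/3) / log 2 (log 2 (1 / eps)))"
      using large_nets_at_scale[of eps c] e0(2)[of eps] c by simp
  qed (use e0(1) in simp)
qed

end
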